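(* Let $\theta(q,x):=\sum_{j=0}^{\infty}q^{j(j+1)/2}x^j$ be the partial theta function. For every fixed $q\in(0,1)$, the function $x\mapsto\theta(q,x)$ has no zeros in the closed domain $$\mathcal{D}:=\{x\in\mathbb{C}:\ |x|\leq 3,\ \mathrm{Re}\,x\leq 0,\ |\mathrm{Im}\,x|\leq 3/\sqrt{2}\}.$$
   Context: For $q\in(0,1)$ the series defining $\theta(q,x)$ converges for all $x\in\mathbb{C}$ and defines an entire function of $x$. *)

theory Defs
  imports "HOL-Analysis.Analysis"
begin

text \<open>Partial theta function: theta q x = sum over j of q^(j(j+1)/2) x^j.
  j*(j+1) is always even, so the nat division is exact.\<close>
definition partial_theta :: "real \<Rightarrow> complex \<Rightarrow> complex" where
  "partial_theta q x = (\<Sum>j. complex_of_real (q ^ (j * (j + 1) div 2)) * x ^ j)"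

end

theory Submission
  imports Defs "HOL-Complex_Analysis.Complex_Analysis"
begin

text \<open>
  Since $\theta(q,x) \to 1/(1-x)$ for $q \to 1$, one may hope that $g(x) = (1-x)\,\theta(q,x)$ has
  positive real part on the domain for all $q$. The real part is harmonic, so it suffices to check
  the boundary: on the imaginary axis, on the lines $|\mathrm{Im}(x)| = 3/\sqrt 2$ and on the arc $|x| = 3$.
  For small $q$ the first few terms of the power series of $g$ decide the sign. For large $q$ write
  $g(x) = (1-x)\,\Theta(q,x) + g(1/x)$, where $\Theta(q,x) = \sum_{j \in Z} q^{j(j+1)/2}x^j$.
  The second term is close to $1$ because $|1/x| \le 1$, and the triple product shows that the
  first is small. The threshold for $q$ depends on the part of the boundary.
\<close>

section \<open>The power series\<close>

text \<open>The factor 1 - x serves twice. It gives 1 - g positive coefficients with sum 1, which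
  controls g on the closed unit disc for all q at once. And (1 - x)/x = -(1 - 1/x), so completing
  the series to the bilateral one subtracts from g(x) the same function at 1/x.

  The lines and the arc meet where |Re x| = |Im x| = 3/sqrt 2, which is where Re (x^2) changes sign:
  it is nonpositive on the axis and the lines, nonnegative on the arc. The numbers 10607/5000 and
  53/25 enclose 3/sqrt 2 from above and below.

  The delicate region is the imaginary axis near |x| = 1 as q tends to 1: the lower bound for Re
  g(1/x) may tend to 0 there, so a fixed bound for the product cannot work, and the rate (1 - q)^2
  of its first factor has to be kept. Elsewhere fixed rational bounds suffice. Polynomial
  inequalities in a = -Re x are made linear in a and a^2 by (a - c)^2 >= 0 and a (a - c)^2 >= 0,
  with c adapted to the range.\<close>

definition theta_coeff :: "real \<Rightarrow> nat \<Rightarrow> real" where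
  "theta_coeff q n = q ^ (n * (n + 1) div 2)"

text \<open>The coefficients of $1 - (1 - x)\,\theta(q,x)$. They telescope: the sum over $n \ge J$ is the $J$-th coefficient of $\theta$.\<close>

definition theta_gap :: "real \<Rightarrow> nat \<Rightarrow> real" where
  "theta_gap q n = theta_coeff q n * (1 - q ^ Suc n)"

lemma theta_coeff_0 [simp]: "theta_coeff q 0 = 1"
  by (simp add: theta_coeff_def)

lemma theta_coeff_Suc: "theta_coeff q (Suc n) = theta_coeff q n * q ^ Suc n"
proof -
  have "Suc n * (Suc n + 1) div 2 = n * (n + 1) div 2 + Suc n"
    by simp
  then show ?thesis
    by (simp only: theta_coeff_def power_add)
qed

lemma theta_gap_eq: "theta_gap q n = theta_coeff q n - theta_coeff q (Suc n)"
  by (simp add: theta_gap_def theta_coeff_Suc algebra_simps)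

lemma partial_theta_eq: "partial_theta q x = (\<Sum>n. complex_of_real (theta_coeff q n) * x ^ n)"
  by (simp add: partial_theta_def theta_coeff_def)

text \<open>The exponents at J + n and J differ by n (J + 1) + n (n - 1)/2; discarding the last
  summand leaves a geometric sequence.\<close>

lemma theta_coeff_add_le:
  assumes "0 \<le> q" "q \<le> 1"
  shows "theta_coeff q (J + n) \<le> theta_coeff q J * (q ^ Suc J) ^ n"
proof (induction n)
  case (Suc n)
  have "theta_coeff q (J + Suc n) = theta_coeff q (J + n) * q ^ Suc (J + n)"
    by (simp add: theta_coeff_Suc)
  also have "\<dots> \<le> (theta_coeff q J * (q ^ Suc J) ^ n) * q ^ Suc J"
    using assms by (intro mult_mono Suc.IH power_decreasing) (auto simp: theta_coeff_def)
  finally show ?case by (simp add: mult_ac)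
qed simp

context
  fixes q :: real
  assumes q: "0 < q" "q < 1"
begin

lemma theta_coeff_pos: "0 < theta_coeff q n"
  using q by (simp add: theta_coeff_def)

lemma theta_gap_pos: "0 < theta_gap q n"
  using q theta_coeff_pos power_Suc_less_one[of q n] by (simp add: theta_gap_def)

lemma theta_gap_le_coeff: "theta_gap q n \<le> theta_coeff q n"
  using theta_coeff_pos[of "Suc n"] by (simp add: theta_gap_eq)

lemma theta_coeff_tendsto_0: "theta_coeff q \<longlonglongrightarrow> 0"
proof (rule real_tendsto_sandwich)
  show "\<forall>\<^sub>F n in sequentially. 0 \<le> theta_coeff q n"
    using theta_coeff_pos by (intro always_eventually allI less_imp_le)
  show "\<forall>\<^sub>F n in sequentially. theta_coeff q n \<le> q ^ n"
    using theta_coeff_add_le[of q 0] q by (auto intro!: always_eventually)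
  show "(\<lambda>n. q ^ n) \<longlonglongrightarrow> 0"
    using q by (intro LIMSEQ_power_zero) auto
qed simp_all

lemma theta_gap_sums: "(\<lambda>n. theta_gap q (n + J)) sums theta_coeff q J"
proof -
  have "(\<lambda>n. theta_coeff q (n + J)) \<longlonglongrightarrow> 0"
    using theta_coeff_tendsto_0 by (rule LIMSEQ_ignore_initial_segment)
  from telescope_sums'[OF this] show ?thesis
    by (simp add: theta_gap_eq)
qed

section \<open>Convergence for every argument, and holomorphy\<close>

lemma summable_theta_coeff_power: "summable (\<lambda>n. theta_coeff q n * r ^ n)" for r :: real
proof -
  have "(\<lambda>n. q ^ n * \<bar>r\<bar>) \<longlonglongrightarrow> 0 * \<bar>r\<bar>"
    using q by (intro tendsto_intros LIMSEQ_power_zero) auto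
  then have "\<forall>\<^sub>F n in sequentially. q ^ n * \<bar>r\<bar> < 1/2"
    by (intro order_tendstoD(2)[of _ 0]) auto
  then obtain N where N: "\<And>n. n \<ge> N \<Longrightarrow> q ^ n * \<bar>r\<bar> < 1/2"
    by (auto simp: eventually_sequentially)
  show ?thesis
  proof (rule summable_ratio_test[of "1/2" N])
    fix n assume "N \<le> n"
    have "norm (theta_coeff q (Suc n) * r ^ Suc n)
        = (q ^ Suc n * \<bar>r\<bar>) * norm (theta_coeff q n * r ^ n)"
      using q theta_coeff_pos[of n] by (simp add: theta_coeff_Suc abs_mult power_abs)
    also have "\<dots> \<le> 1/2 * norm (theta_coeff q n * r ^ n)"
      using N[of "Suc n"] \<open>N \<le> n\<close> by (intro mult_right_mono) auto
    finally show "norm (theta_coeff q (Suc n) * r ^ Suc n) \<le> 1/2 * norm (theta_coeff q n * r ^ n)" .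
  qed simp
qed

lemma summable_norm_partial_theta: "summable (\<lambda>n. norm (complex_of_real (theta_coeff q n) * x ^ n))"
  using summable_theta_coeff_power[of "norm x"]
  by (simp add: norm_mult norm_power abs_of_pos[OF theta_coeff_pos])

lemma summable_partial_theta: "summable (\<lambda>n. complex_of_real (theta_coeff q n) * x ^ n)"
  using summable_norm_partial_theta by (rule summable_norm_cancel)

lemma holomorphic_partial_theta: "partial_theta q holomorphic_on A"
proof -
  have "(partial_theta q has_field_derivative (\<Sum>n. diffs (\<lambda>n. complex_of_real (theta_coeff q n)) n * x ^ n)) (at x)" for x
    unfolding partial_theta_eq [abs_def]
    by (intro termdiffs_strong_converges_everywhere summable_partial_theta)
  then show ?thesis
    unfolding holomorphic_on_def field_differentiable_def
    using has_field_derivative_at_within by blast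
qed

lemma one_minus_partial_theta_sums:
  "(\<lambda>n. complex_of_real (theta_gap q n) * x ^ Suc n) sums (1 - (1 - x) * partial_theta q x)"
proof -
  let ?f = "\<lambda>n. complex_of_real (theta_coeff q n) * x ^ n"
  have s: "?f sums partial_theta q x"
    using summable_partial_theta by (simp add: partial_theta_eq summable_sums)
  then have "(\<lambda>n. ?f (Suc n)) sums (partial_theta q x - 1)"
    by (subst sums_Suc_iff) simp
  with sums_mult[OF s, of x]
  have "(\<lambda>n. x * ?f n - ?f (Suc n)) sums (x * partial_theta q x - (partial_theta q x - 1))"
    by (rule sums_diff)
  then show ?thesis
    by (simp add: theta_gap_eq algebra_simps)
qed

section \<open>Lower bounds for the real part: explicit head, estimated tail\<close>

lemma Re_one_minus_partial_theta:
  "(\<lambda>n. theta_gap q (n + J) * Re (x ^ Suc (n + J))) sums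
     (1 - (\<Sum>n<J. theta_gap q n * Re (x ^ Suc n)) - Re ((1 - x) * partial_theta q x))"
proof -
  have "(\<lambda>n. theta_gap q n * Re (x ^ Suc n)) sums (1 - Re ((1 - x) * partial_theta q x))"
    using sums_Re[OF one_minus_partial_theta_sums[of x]] by (simp del: power_Suc)
  from sums_split_initial_segment[OF this, of J] show ?thesis
    by (simp add: algebra_simps del: power_Suc)
qed

text \<open>Signs are kept only in the head of J terms; the tail is bounded in modulus by a
  geometric series of ratio \<open>q ^ Suc J * r\<close>. This allows |x| > 1 but degenerates as q
  grows.\<close>

lemma Re_partial_theta_ge_outer:
  assumes r: "norm x \<le> r" and small: "q ^ Suc J * r < 1"
  shows "1 - (\<Sum>n<J. theta_gap q n * Re (x ^ Suc n)) - theta_coeff q J * r ^ Suc J / (1 - q ^ Suc J * r)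
           \<le> Re ((1 - x) * partial_theta q x)"
proof -
  have r0: "0 \<le> r" using r norm_ge_zero order_trans by blast
  have "norm (q ^ Suc J * r) < 1" using small q r0 by (simp add: abs_mult)
  from sums_mult[OF geometric_sums[OF this], of "theta_coeff q J * r ^ Suc J"]
  have G: "(\<lambda>n. theta_coeff q J * r ^ Suc J * (q ^ Suc J * r) ^ n) sums
           (theta_coeff q J * r ^ Suc J / (1 - q ^ Suc J * r))"
    by simp
  have "theta_gap q (n + J) * Re (x ^ Suc (n + J)) \<le> theta_coeff q J * r ^ Suc J * (q ^ Suc J * r) ^ n" for n
  proof -
    have "Re (x ^ Suc (n + J)) \<le> r ^ Suc (n + J)"
      using complex_Re_le_cmod[of "x ^ Suc (n + J)"] power_mono[OF r norm_ge_zero, of "Suc (n + J)"]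
      by (simp add: norm_power del: power_Suc)
    then have "theta_gap q (n + J) * Re (x ^ Suc (n + J)) \<le> theta_gap q (n + J) * r ^ Suc (n + J)"
      using theta_gap_pos by (simp add: less_imp_le mult_left_mono)
    also have "\<dots> \<le> (theta_coeff q J * (q ^ Suc J) ^ n) * r ^ Suc (n + J)"
      using theta_gap_le_coeff[of "n + J"] theta_coeff_add_le[of q J n] q r0
      by (intro mult_right_mono) (auto simp: add.commute)
    also have "\<dots> = theta_coeff q J * r ^ Suc J * (q ^ Suc J * r) ^ n"
      by (simp add: power_add power_mult_distrib mult_ac)
    finally show ?thesis .
  qed
  from sums_le[OF this Re_one_minus_partial_theta G] show ?thesis
    by simp
qed

text \<open>In the unit disc all powers in the tail are at most \<open>r ^ Suc J\<close>, and the
  coefficients telescope to \<open>theta_coeff q J\<close>. Unlike the geometric bound, this one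
  survives q tending to 1, which is what the reflected point 1/x needs.\<close>

lemma Re_partial_theta_ge_inner:
  assumes r: "norm x \<le> r" "r \<le> 1"
  shows "1 - (\<Sum>n<J. theta_gap q n * Re (x ^ Suc n)) - theta_coeff q J * r ^ Suc J
           \<le> Re ((1 - x) * partial_theta q x)"
proof -
  have r0: "0 \<le> r" using r norm_ge_zero order_trans by blast
  have "theta_gap q (n + J) * Re (x ^ Suc (n + J)) \<le> theta_gap q (n + J) * r ^ Suc J" for n
  proof (intro mult_left_mono less_imp_le[OF theta_gap_pos])
    have "Re (x ^ Suc (n + J)) \<le> r ^ Suc (n + J)"
      using complex_Re_le_cmod[of "x ^ Suc (n + J)"] power_mono[OF r(1) norm_ge_zero, of "Suc (n + J)"]
      by (simp add: norm_power del: power_Suc)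
    also have "\<dots> \<le> r ^ Suc J"
      using r r0 by (intro power_decreasing) auto
    finally show "Re (x ^ Suc (n + J)) \<le> r ^ Suc J" .
  qed
  from sums_le[OF this Re_one_minus_partial_theta sums_mult2[OF theta_gap_sums]] show ?thesis
    by simp
qed

end

section \<open>The Jacobi triple product\<close>

definition qpoch :: "real \<Rightarrow> nat \<Rightarrow> real" where
  "qpoch q m = (\<Prod>n<m. 1 - q ^ Suc n)"

text \<open>The Gaussian binomial coefficient. The value 0 for k > m lets the Pascal rule hold
  without a side condition.\<close>

definition qbinom :: "real \<Rightarrow> nat \<Rightarrow> nat \<Rightarrow> real" where
  "qbinom q m k = (if k \<le> m then qpoch q m / (qpoch q k * qpoch q (m - k)) else 0)"

lemma theta_coeff_eq_prod: "theta_coeff q m = (\<Prod>i\<le>m. q ^ i)"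
proof (induction m)
  case (Suc m)
  then show ?case by (simp only: theta_coeff_Suc prod.atMost_Suc)
qed simp

lemma theta_coeff_add: "theta_coeff q (m + n) = theta_coeff q m * theta_coeff q n * q ^ (m * n)"
proof (induction n)
  case (Suc n)
  then show ?case
    by (simp add: theta_coeff_Suc power_add mult_ac)
qed simp

lemma theta_coeff_square: "theta_coeff q n * theta_coeff q n = q ^ (n * (n + 1))"
proof -
  have "n * (n + 1) div 2 + n * (n + 1) div 2 = n * (n + 1)"
    by (subst mult_2 [symmetric]) (rule dvd_mult_div_cancel, simp)
  then show ?thesis
    by (simp only: theta_coeff_def flip: power_add)
qed

text \<open>With T(n) = n (n + 1)/2 this is T(m+1+i) + T(m) = T(i) + (m+1)(m+1+i). It cancels the
  power of q that the substitution of x/q^(m+1) introduces in the upper half of the q-binomial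
  sum.\<close>

lemma theta_coeff_shift_up:
  "theta_coeff q (m + 1 + i) * theta_coeff q m = theta_coeff q i * (q ^ Suc m) ^ (m + 1 + i)"
proof -
  have "theta_coeff q (Suc m) * theta_coeff q m = q ^ (m * (m + 1)) * q ^ Suc m"
    by (simp only: theta_coeff_Suc flip: theta_coeff_square) (simp only: mult_ac)
  also have "\<dots> = q ^ (Suc m * Suc m)"
    by (simp add: algebra_simps flip: power_add power_Suc)
  finally have *: "theta_coeff q (Suc m) * theta_coeff q m = q ^ (Suc m * Suc m)" .
  have "theta_coeff q (Suc m + i) * theta_coeff q m = theta_coeff q i * (q ^ (Suc m * Suc m) * q ^ (Suc m * i))"
    by (simp only: theta_coeff_add flip: *) (simp only: mult_ac)
  then show ?thesis
    by (simp only: Suc_eq_plus1 flip: power_add distrib_left power_mult)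
qed

text \<open>The counterpart for the lower half of the sum, applied with l = m - i: T(l) + T(i+l) =
  T(i) + (i+l+1) l.\<close>

lemma theta_coeff_shift_down:
  "theta_coeff q l * theta_coeff q (i + l) = theta_coeff q i * (q ^ Suc (i + l)) ^ l"
proof -
  have "theta_coeff q l * theta_coeff q (i + l)
      = theta_coeff q i * (theta_coeff q l * theta_coeff q l) * q ^ (i * l)"
    by (simp add: theta_coeff_add mult_ac)
  also have "\<dots> = theta_coeff q i * q ^ (l * (l + 1) + i * l)"
    by (simp add: theta_coeff_square power_add)
  also have "l * (l + 1) + i * l = Suc (i + l) * l"
    by (simp add: algebra_simps)
  finally show ?thesis
    by (simp only: power_mult)
qed

lemma qbinom_sym: "k \<le> m \<Longrightarrow> qbinom q m (m - k) = qbinom q m k"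
  by (simp add: qbinom_def mult.commute)

lemma triple_sum_split:
  fixes g :: "nat \<Rightarrow> complex"
  shows "(\<Sum>k\<le>2*m+1. g k) = (\<Sum>i\<le>m. g (m - i) + g (m + 1 + i))"
proof -
  have "{..2*m+1} = {..m} \<union> {Suc m..2*m+1}" by auto
  then have "(\<Sum>k\<le>2*m+1. g k) = (\<Sum>k\<le>m. g k) + (\<Sum>k=Suc m..2*m+1. g k)"
    by (simp only:) (rule sum.union_disjoint, auto)
  also have "(\<Sum>k\<le>m. g k) = (\<Sum>i\<le>m. g (m - i))"
    by (rule sum.reindex_bij_witness[of _ "\<lambda>i. m - i" "\<lambda>i. m - i"]) auto
  also have "(\<Sum>k=Suc m..2*m+1. g k) = (\<Sum>i\<le>m. g (m + 1 + i))"
    by (rule sum.reindex_bij_witness[of _ "\<lambda>i. m + 1 + i" "\<lambda>i. i - Suc m"]) auto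
  finally show ?thesis
    by (simp only: sum.distrib)
qed

lemma triple_prod_split:
  fixes f :: "nat \<Rightarrow> complex"
  shows "(\<Prod>k<2*m+1. f k) = (\<Prod>k<Suc m. f k) * (\<Prod>k=Suc m..<Suc m + m. f k)"
proof -
  have "{..<2*m+1} = {..<Suc m} \<union> {Suc m..<Suc m + m}"
    by auto
  moreover have "{..<Suc m} \<inter> {Suc m..<Suc m + m} = {}"
    by auto
  ultimately show ?thesis
    using prod.union_disjoint[of "{..<Suc m}" "{Suc m..<Suc m + m}" f] finite_lessThan finite_atLeastLessThan by metis
qed

context
  fixes q :: real
  assumes q: "0 < q" "q < 1"
begin

section \<open>Finite q-products, the q-Pascal rule and the q-binomial theorem\<close>

lemma qpoch_pos: "0 < qpoch q m"
  using q power_Suc_less_one[of q] by (auto simp: qpoch_def intro!: prod_pos)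

lemma qpoch_0: "qpoch q 0 = 1"
  by (simp add: qpoch_def)

lemma qpoch_Suc: "qpoch q (Suc m) = qpoch q m * (1 - q ^ Suc m)"
  by (simp add: qpoch_def)

lemma qpoch_antimono: "m \<le> n \<Longrightarrow> qpoch q n \<le> qpoch q m"
proof (induction n rule: dec_induct)
  case (step n)
  have "qpoch q (Suc n) \<le> qpoch q n * 1"
    unfolding qpoch_Suc using q qpoch_pos[of n] by (intro mult_left_mono) auto
  then show ?case using step by simp
qed simp

text \<open>That the limit is nonzero makes quotients of these products tend to 1, as the passage to
  the infinite triple product requires.\<close>

lemma qpoch_tendsto: "\<exists>L. qpoch q \<longlonglongrightarrow> L \<and> L \<noteq> 0"
proof -
  have "summable (\<lambda>n. norm ((1 - q ^ Suc n) - 1))"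
    using q summable_geometric[of q] by (simp add: abs_mult power_abs summable_mult)
  then have "convergent_prod (\<lambda>n. 1 - q ^ Suc n)"
    by (intro abs_convergent_prod_imp_convergent_prod summable_imp_abs_convergent_prod)
  moreover have "1 - q ^ Suc n \<noteq> 0" for n
    using power_Suc_less_one[of q n] q by simp
  ultimately have "\<exists>L. (\<lambda>n. \<Prod>i\<le>n. 1 - q ^ Suc i) \<longlonglongrightarrow> L \<and> L \<noteq> 0"
    by (subst (asm) convergent_prod_iff_nz_lim)
  then obtain L where "(\<lambda>n. \<Prod>i\<le>n. 1 - q ^ Suc i) \<longlonglongrightarrow> L" "L \<noteq> 0"
    by blast
  moreover from this(1) have "qpoch q \<longlonglongrightarrow> L"
    by (subst filterlim_sequentially_Suc [symmetric]) (simp add: qpoch_def lessThan_Suc_atMost)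
  ultimately show ?thesis by blast
qed

lemma qbinom_Suc_Suc:
  "qbinom q (Suc m) (Suc k) = qbinom q m (Suc k) + q ^ (m - k) * qbinom q m k"
proof -
  consider "k < m" | "k = m" | "k > m" by linarith
  then show ?thesis
  proof cases
    case 1
    define l where "l = m - Suc k"
    have m: "m = Suc (k + l)" using 1 by (simp add: l_def)
    have *: "1 - q ^ Suc n \<noteq> 0" for n
      using power_Suc_less_one[of q n] q by simp
    have C: "q ^ Suc m = q ^ Suc k * q ^ Suc l"
      by (simp add: m flip: power_add power_Suc)
    \<comment> \<open>The Pascal rule is the identity 1 - A B = (1 - B) + B (1 - A), for A = q^(k+1)
      and B = q^(l+1).\<close>
    have alg: "W * (1 - A * B) / ((K * (1 - A)) * (L * (1 - B))) = W / ((K * (1 - A)) * L) + B * (W / (K * (L * (1 - B))))"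
      if "K \<noteq> 0" "L \<noteq> 0" "1 - A \<noteq> 0" "1 - B \<noteq> 0" for W K L A B :: real
      using that by (simp add: divide_simps) (simp add: algebra_simps)
    have "qbinom q (Suc m) (Suc k) = qpoch q m * (1 - q ^ Suc k * q ^ Suc l) / ((qpoch q k * (1 - q ^ Suc k)) * (qpoch q l * (1 - q ^ Suc l)))"
      using 1 by (simp only: qbinom_def qpoch_Suc C[symmetric]) (simp add: m qpoch_Suc)
    also have "\<dots> = qpoch q m / ((qpoch q k * (1 - q ^ Suc k)) * qpoch q l) + q ^ Suc l * (qpoch q m / (qpoch q k * (qpoch q l * (1 - q ^ Suc l))))"
      using qpoch_pos[of k] qpoch_pos[of l] by (intro alg *) auto
    also have "\<dots> = qbinom q m (Suc k) + q ^ (m - k) * qbinom q m k"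
      using 1 by (simp add: qbinom_def qpoch_Suc m Suc_diff_le)
    finally show ?thesis .
  next
    case 2
    then show ?thesis using qpoch_pos[of m] qpoch_pos[of "Suc m"]
      by (simp add: qbinom_def qpoch_0)
  qed (simp add: qbinom_def)
qed

text \<open>The finite q-binomial theorem. Induction on m: the new factor 1 + y q^(m+1) reproduces
  the Pascal rule coefficient by coefficient.\<close>

lemma prod_qbinom:
  fixes y :: complex
  shows "(\<Prod>n<m. 1 + y * of_real (q ^ Suc n)) =
         (\<Sum>k\<le>m. of_real (qbinom q m k * theta_coeff q k) * y ^ k)"
proof (induction m)
  case 0
  show ?case by (simp add: qbinom_def qpoch_def)
next
  case (Suc m)
  let ?c = "\<lambda>m k. complex_of_real (qbinom q m k * theta_coeff q k) * y ^ k"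
  have step: "?c (Suc m) (Suc k) = ?c m (Suc k) + ?c m k * (y * of_real (q ^ Suc m))" if "k \<le> m" for k
  proof -
    have "q ^ (m - k) * q ^ Suc k = q ^ Suc m"
      using that by (simp flip: power_add power_Suc)
    then have "qbinom q (Suc m) (Suc k) * theta_coeff q (Suc k) =
        qbinom q m (Suc k) * theta_coeff q (Suc k) + qbinom q m k * theta_coeff q k * q ^ Suc m"
      by (simp only: qbinom_Suc_Suc theta_coeff_Suc flip: \<open>_ = q ^ Suc m\<close>)
         (simp only: algebra_simps)
    then show ?thesis
      by (simp only: of_real_add of_real_mult) (simp add: algebra_simps)
  qed
  have "(\<Sum>k\<le>Suc m. ?c (Suc m) k) = ?c (Suc m) 0 + (\<Sum>k\<le>m. ?c (Suc m) (Suc k))"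
    by (rule sum.atMost_Suc_shift)
  also have "(\<Sum>k\<le>m. ?c (Suc m) (Suc k)) =
      (\<Sum>k\<le>m. ?c m (Suc k)) + (\<Sum>k\<le>m. ?c m k) * (y * of_real (q ^ Suc m))"
    unfolding sum_distrib_right sum.distrib[symmetric] by (intro sum.cong refl step) simp
  also have "?c (Suc m) 0 = ?c m 0"
    using qpoch_pos[of m] qpoch_pos[of "Suc m"] by (simp add: qbinom_def qpoch_0)
  also have "?c m 0 + ((\<Sum>k\<le>m. ?c m (Suc k)) + (\<Sum>k\<le>m. ?c m k) * (y * of_real (q ^ Suc m)))
     = (\<Sum>k\<le>Suc m. ?c m k) + (\<Sum>k\<le>m. ?c m k) * (y * of_real (q ^ Suc m))"
    by (simp only: sum.atMost_Suc_shift add.assoc)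
  also have "(\<Sum>k\<le>Suc m. ?c m k) = (\<Sum>k\<le>m. ?c m k)"
    by (simp add: qbinom_def)
  finally show ?case
    by (simp only: Suc.IH prod.lessThan_Suc) (simp add: algebra_simps)
qed

section \<open>Recentring the q-binomial theorem: the finite triple product\<close>

lemma triple_prod_upper:
  fixes x :: complex
  shows "(\<Prod>k=Suc m..<Suc m + m. 1 + x / of_real q ^ Suc m * of_real (q ^ Suc k)) =
         (\<Prod>n<m. 1 + x * of_real (q ^ Suc n))"
proof (rule prod.reindex_bij_witness[of _ "\<lambda>i. i + Suc m" "\<lambda>i. i - Suc m"])
  fix k assume "k \<in> {Suc m..<Suc m + m}"
  then have "Suc m + Suc (k - Suc m) = Suc k" by simp
  then have "q ^ Suc k = q ^ Suc m * q ^ Suc (k - Suc m)"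
    by (simp only: flip: power_add)
  moreover have "complex_of_real q ^ Suc m \<noteq> 0"
    using q by simp
  ultimately show "1 + x * of_real (q ^ Suc (k - Suc m)) = 1 + x / of_real q ^ Suc m * of_real (q ^ Suc k)"
    by (simp only: of_real_mult of_real_power) (simp del: power_Suc)
qed auto

lemma triple_prod_lower:
  fixes x :: complex
  assumes x: "x \<noteq> 0"
  shows "(\<Prod>k<Suc m. 1 + x / of_real q ^ Suc m * of_real (q ^ Suc k)) =
         x ^ Suc m / of_real (theta_coeff q m) * (\<Prod>i\<le>m. 1 + of_real (q ^ i) / x)"
proof -
  have "(\<Prod>k<Suc m. 1 + x / of_real q ^ Suc m * of_real (q ^ Suc k)) =
        (\<Prod>i\<le>m. (x / of_real (q ^ i)) * (1 + of_real (q ^ i) / x))"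
  proof (rule prod.reindex_bij_witness[of _ "\<lambda>i. m - i" "\<lambda>i. m - i"])
    fix k assume "k \<in> {..<Suc m}"
    then have "Suc k + (m - k) = Suc m" by simp
    then have "q ^ Suc m = q ^ Suc k * q ^ (m - k)"
      by (simp only: flip: power_add)
    then have "x / of_real q ^ Suc m * of_real (q ^ Suc k) = x / of_real (q ^ (m - k))"
      using q by (simp only: flip: of_real_power) (simp del: power_Suc of_real_power)
    moreover have "x / of_real (q ^ (m - k)) * (1 + of_real (q ^ (m - k)) / x) = x / of_real (q ^ (m - k)) + 1"
      using x q by (simp add: distrib_left)
    ultimately show "x / of_real (q ^ (m - k)) * (1 + of_real (q ^ (m - k)) / x) =
        1 + x / of_real q ^ Suc m * of_real (q ^ Suc k)"
      by (simp only: add.commute)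
  qed auto
  also have "\<dots> = x ^ Suc m / of_real (theta_coeff q m) * (\<Prod>i\<le>m. 1 + of_real (q ^ i) / x)"
    by (simp only: prod.distrib prod_dividef prod_constant card_atMost theta_coeff_eq_prod of_real_prod)
  finally show ?thesis .
qed

lemma triple_term_upper:
  fixes x :: complex
  assumes x: "x \<noteq> 0"
  shows "of_real (theta_coeff q m) / x ^ Suc m *
           (of_real (theta_coeff q (m + 1 + i)) * (x / of_real q ^ Suc m) ^ (m + 1 + i)) =
         of_real (theta_coeff q i) * x ^ i"
proof -
  have "of_real (theta_coeff q m) / x ^ Suc m * (of_real (theta_coeff q (m + 1 + i)) * (x / of_real q ^ Suc m) ^ (m + 1 + i))
      = of_real (theta_coeff q (m + 1 + i) * theta_coeff q m) / of_real ((q ^ Suc m) ^ (m + 1 + i)) * (x ^ (m + 1 + i) / x ^ Suc m)"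
    by (simp only: power_divide of_real_mult of_real_power times_divide_times_eq times_divide_eq_left times_divide_eq_right mult_ac)
  also have "\<dots> = of_real (theta_coeff q i) * (x ^ (m + 1 + i) / x ^ Suc m)"
    using q by (simp only: theta_coeff_shift_up) (simp del: power_Suc)
  also have "x ^ (m + 1 + i) = x ^ Suc m * x ^ i"
    by (simp only: Suc_eq_plus1 flip: power_add)
  finally show ?thesis
    using x by (simp del: power_Suc)
qed

lemma triple_term_lower:
  fixes x :: complex
  assumes x: "x \<noteq> 0" and i: "i \<le> m"
  shows "of_real (theta_coeff q m) / x ^ Suc m *
           (of_real (theta_coeff q (m - i)) * (x / of_real q ^ Suc m) ^ (m - i)) =
         of_real (theta_coeff q i) * (1 / x ^ Suc i)"
proof -
  have d: "theta_coeff q (m - i) * theta_coeff q m = theta_coeff q i * (q ^ Suc m) ^ (m - i)"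
    using theta_coeff_shift_down[of q "m - i" i] i by (simp del: power_Suc)
  have "m - i + Suc i = Suc m" using i by simp
  then have xm: "x ^ Suc m = x ^ (m - i) * x ^ Suc i"
    by (simp only: flip: power_add)
  have "of_real (theta_coeff q m) / x ^ Suc m * (of_real (theta_coeff q (m - i)) * (x / of_real q ^ Suc m) ^ (m - i))
      = of_real (theta_coeff q (m - i) * theta_coeff q m) / of_real ((q ^ Suc m) ^ (m - i)) * (x ^ (m - i) / x ^ Suc m)"
    by (simp only: power_divide of_real_mult of_real_power times_divide_times_eq times_divide_eq_left times_divide_eq_right mult_ac)
  also have "\<dots> = of_real (theta_coeff q i) * (x ^ (m - i) / x ^ Suc m)"
    using q by (simp only: d) (simp del: power_Suc)
  also have "x ^ (m - i) / x ^ Suc m = 1 / x ^ Suc i"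
    using x by (simp add: xm del: power_Suc)
  finally show ?thesis .
qed

text \<open>The q-binomial theorem for 2m+1 factors at y = x/q^(m+1). The upper m factors become 1 +
  x q^n, the lower m+1 become (x/q^i)(1 + q^i/x), and \<open>c\<close> removes the monomial split
  off from the latter. Since the Gaussian coefficients are symmetric, x^i and x^(-i-1) share one
  coefficient.\<close>

lemma finite_triple_product:
  fixes x :: complex
  assumes x: "x \<noteq> 0"
  shows "(\<Prod>n\<le>m. 1 + of_real (q ^ n) / x) * (\<Prod>n<m. 1 + x * of_real (q ^ Suc n)) =
         (\<Sum>i\<le>m. of_real (qbinom q (2 * m + 1) (m - i) * theta_coeff q i) * (x ^ i + 1 / x ^ Suc i))"
proof -
  define y where "y = x / complex_of_real q ^ Suc m"
  define c where "c = complex_of_real (theta_coeff q m) / x ^ Suc m"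
  let ?g = "\<lambda>k. of_real (qbinom q (2*m+1) k * theta_coeff q k) * y ^ k"
  have c: "c \<noteq> 0" using x q by (simp add: c_def theta_coeff_def)
  have "(\<Prod>k<2*m+1. 1 + y * of_real (q ^ Suc k)) =
      1 / c * ((\<Prod>n\<le>m. 1 + of_real (q ^ n) / x) * (\<Prod>n<m. 1 + x * of_real (q ^ Suc n)))"
    by (rule trans[OF triple_prod_split], unfold y_def triple_prod_upper triple_prod_lower[OF x] c_def)
       (simp del: power_Suc prod.lessThan_Suc)
  then have "(\<Prod>n\<le>m. 1 + of_real (q ^ n) / x) * (\<Prod>n<m. 1 + x * of_real (q ^ Suc n))
      = c * (\<Prod>k<2*m+1. 1 + y * of_real (q ^ Suc k))"
    using c by (simp only:) simp
  also have "\<dots> = (\<Sum>i\<le>m. c * (?g (m - i) + ?g (m + 1 + i)))"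
    unfolding prod_qbinom triple_sum_split sum_distrib_left ..
  also have "\<dots> = (\<Sum>i\<le>m. of_real (qbinom q (2 * m + 1) (m - i) * theta_coeff q i) * (x ^ i + 1 / x ^ Suc i))"
  proof (intro sum.cong refl)
    fix i assume "i \<in> {..m}"
    then have i: "i \<le> m" by simp
    have "2 * m + 1 - (m - i) = m + 1 + i" using i by simp
    then have sym: "qbinom q (2*m+1) (m + 1 + i) = qbinom q (2*m+1) (m - i)"
      using qbinom_sym[of "m - i" "2 * m + 1"] by simp
    have "c * (?g (m - i) + ?g (m + 1 + i)) = of_real (qbinom q (2*m+1) (m - i)) *
       (c * (of_real (theta_coeff q (m - i)) * y ^ (m - i)) + c * (of_real (theta_coeff q (m + 1 + i)) * y ^ (m + 1 + i)))"
      unfolding sym of_real_mult by (simp only: distrib_left mult_ac)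
    also have "\<dots> = of_real (qbinom q (2*m+1) (m - i)) *
       (of_real (theta_coeff q i) * (1 / x ^ Suc i) + of_real (theta_coeff q i) * x ^ i)"
      unfolding c_def y_def triple_term_upper[OF x] triple_term_lower[OF x i] ..
    also have "\<dots> = of_real (qbinom q (2 * m + 1) (m - i) * theta_coeff q i) * (x ^ i + 1 / x ^ Suc i)"
      unfolding of_real_mult by (simp only: distrib_left distrib_right mult_ac add_ac)
    finally show "c * (?g (m - i) + ?g (m + 1 + i)) =
      of_real (qbinom q (2 * m + 1) (m - i) * theta_coeff q i) * (x ^ i + 1 / x ^ Suc i)" .
  qed
  finally show ?thesis .
qed

end

text \<open>The squared modulus of a factor of the triple product, where $u$ stands for $q^n$.\<close>

definition triple_factor :: "complex \<Rightarrow> real \<Rightarrow> real" where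
  "triple_factor x u = ((1 - u) * cmod (1 + x * of_real u) * cmod (1 + of_real u / x))\<^sup>2"

section \<open>From the finite to the infinite triple product\<close>

context
  fixes q :: real
  assumes q: "0 < q" "q < 1"
begin

text \<open>The normalisation by \<open>qpoch q m\<close> yields two quotients, each at most 1 and
  tending to 1 as m grows: the domination and the termwise limit for Tannery's theorem.\<close>

lemma qpoch_qbinom_central:
  assumes "i \<le> m"
  shows "qpoch q m * qbinom q (2 * m + 1) (m - i) =
         (qpoch q m / qpoch q (m - i)) * (qpoch q (2 * m + 1) / qpoch q (m + 1 + i))"
proof -
  have "2 * m + 1 - (m - i) = m + 1 + i" using assms by simp
  then show ?thesis using assms by (simp add: qbinom_def)
qed

lemma qpoch_qbinom_central_le: "\<bar>qpoch q m * qbinom q (2 * m + 1) (m - i)\<bar> \<le> 1" if "i \<le> m"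
proof -
  have le: "0 \<le> qpoch q n / qpoch q l" "qpoch q n / qpoch q l \<le> 1" if "l \<le> n" for l n
    using qpoch_antimono[OF q that] qpoch_pos[OF q, of l] qpoch_pos[OF q, of n] by (auto simp: divide_simps)
  show ?thesis
    unfolding qpoch_qbinom_central[OF that] abs_mult
    using le[of "m - i" m] le[of "m + 1 + i" "2 * m + 1"] that by (intro mult_le_one) auto
qed

lemma qpoch_qbinom_central_tendsto: "(\<lambda>m. qpoch q m * qbinom q (2 * m + 1) (m - i)) \<longlonglongrightarrow> 1"
proof -
  obtain L where L: "qpoch q \<longlonglongrightarrow> L" "L \<noteq> 0"
    using qpoch_tendsto[OF q] by blast
  have sub: "(\<lambda>m. qpoch q (f m)) \<longlonglongrightarrow> L" if "filterlim f at_top at_top" for f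
    using filterlim_compose[OF L(1) that] .
  have 1: "filterlim (\<lambda>m. 2 * m + 1) at_top (at_top :: nat filter)"
    by (rule filterlim_at_top_mono[OF filterlim_ident]) auto
  have 2: "filterlim (\<lambda>m. m + 1 + i) at_top (at_top :: nat filter)"
    by (rule filterlim_at_top_mono[OF filterlim_ident]) auto
  have "(\<lambda>m. (qpoch q m / qpoch q (m - i)) * (qpoch q (2 * m + 1) / qpoch q (m + 1 + i))) \<longlonglongrightarrow> (L / L) * (L / L)"
    by (intro tendsto_intros sub L 1 2 filterlim_minus_const_nat_at_top)
  moreover have "\<forall>\<^sub>F m in sequentially. (qpoch q m / qpoch q (m - i)) * (qpoch q (2 * m + 1) / qpoch q (m + 1 + i))
      = qpoch q m * qbinom q (2 * m + 1) (m - i)"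
    using eventually_ge_at_top[of i] by eventually_elim (simp only: qpoch_qbinom_central)
  ultimately show ?thesis
    using L(2) by (auto dest: Lim_transform_eventually)
qed

text \<open>Since T(-i-1) = T(i) for T(n) = n (n + 1)/2, the negative indices of the bilateral
  series contribute \<open>partial_theta q (1 / x) / x\<close>. The finite identities, extended by
  zero for i > m, converge by Tannery's theorem with dominating terms
  \<open>norm (b i)\<close>.\<close>

lemma jacobi_triple_product:
  fixes x :: complex
  assumes x: "x \<noteq> 0"
  shows "(\<lambda>m. of_real (qpoch q m) * ((\<Prod>n\<le>m. 1 + of_real (q ^ n) / x) * (\<Prod>n<m. 1 + x * of_real (q ^ Suc n))))
           \<longlonglongrightarrow> partial_theta q x + partial_theta q (1 / x) / x"
proof -
  define b where "b = (\<lambda>i. complex_of_real (theta_coeff q i) * (x ^ i + 1 / x ^ Suc i))"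
  define a where "a = (\<lambda>i m. if i \<le> m then of_real (qpoch q m * qbinom q (2 * m + 1) (m - i)) * b i else 0)"
  have sum_a: "suminf (\<lambda>i. a i m) = of_real (qpoch q m) *
      ((\<Prod>n\<le>m. 1 + of_real (q ^ n) / x) * (\<Prod>n<m. 1 + x * of_real (q ^ Suc n)))" for m
  proof -
    have "suminf (\<lambda>i. a i m) = (\<Sum>i\<le>m. a i m)"
      by (rule suminf_finite) (auto simp: a_def)
    also have "\<dots> = of_real (qpoch q m) *
       (\<Sum>i\<le>m. of_real (qbinom q (2 * m + 1) (m - i) * theta_coeff q i) * (x ^ i + 1 / x ^ Suc i))"
      unfolding sum_distrib_left
      by (intro sum.cong refl) (simp add: a_def b_def mult_ac)
    finally show ?thesis
      by (simp only: finite_triple_product[OF q x])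
  qed
  have outer: "(\<lambda>i. complex_of_real (theta_coeff q i) * x ^ i) sums partial_theta q x"
    using summable_partial_theta[OF q] by (simp add: partial_theta_eq summable_sums)
  have "(\<lambda>i. complex_of_real (theta_coeff q i) * (1 / x) ^ i) sums partial_theta q (1 / x)"
    using summable_partial_theta[OF q] by (simp add: partial_theta_eq summable_sums)
  from sums_divide[OF this, of x]
  have inner: "(\<lambda>i. complex_of_real (theta_coeff q i) * (1 / x ^ Suc i)) sums (partial_theta q (1 / x) / x)"
    by (simp add: power_divide mult_ac)
  have b: "b sums (partial_theta q x + partial_theta q (1 / x) / x)"
    using sums_add[OF outer inner] unfolding b_def by (simp only: distrib_left)
  have "summable (\<lambda>i. norm (complex_of_real (theta_coeff q i) * x ^ i)
                    + norm (complex_of_real (theta_coeff q i) * (1 / x) ^ i) / norm x)"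
    by (intro summable_add summable_divide summable_norm_partial_theta q)
  then have norm_b: "summable (\<lambda>i. norm (b i))"
  proof (rule summable_comparison_test'[where N = 0])
    fix i
    have "b i = complex_of_real (theta_coeff q i) * x ^ i + complex_of_real (theta_coeff q i) * (1 / x) ^ i / x"
      by (simp add: b_def algebra_simps power_divide)
    then show "norm (norm (b i)) \<le> norm (complex_of_real (theta_coeff q i) * x ^ i)
                    + norm (complex_of_real (theta_coeff q i) * (1 / x) ^ i) / norm x"
      using norm_triangle_ineq[of "complex_of_real (theta_coeff q i) * x ^ i"
          "complex_of_real (theta_coeff q i) * (1 / x) ^ i / x"]
      by (simp add: norm_divide)
  qed
  have "(\<lambda>m. suminf (\<lambda>i. a i m)) \<longlonglongrightarrow> suminf b"
  proof (intro conjunct2[OF conjunct2[OF tannerys_theorem]])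
    fix i
    have "(\<lambda>m. of_real (qpoch q m * qbinom q (2 * m + 1) (m - i)) * b i) \<longlonglongrightarrow> of_real 1 * b i"
      by (intro tendsto_intros qpoch_qbinom_central_tendsto)
    moreover have "\<forall>\<^sub>F m in sequentially. of_real (qpoch q m * qbinom q (2 * m + 1) (m - i)) * b i = a i m"
      using eventually_ge_at_top[of i] by eventually_elim (simp add: a_def)
    ultimately show "(\<lambda>m. a i m) \<longlonglongrightarrow> b i"
      by (auto dest: Lim_transform_eventually)
  next
    have "norm (a i m) \<le> norm (b i)" for i m
    proof (cases "i \<le> m")
      case True
      have "norm (a i m) = \<bar>qpoch q m * qbinom q (2 * m + 1) (m - i)\<bar> * norm (b i)"
        using True by (simp add: a_def norm_mult abs_mult)
      also have "\<dots> \<le> 1 * norm (b i)"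
        using True by (intro mult_right_mono qpoch_qbinom_central_le) auto
      finally show ?thesis by simp
    qed (simp add: a_def)
    then show "\<forall>\<^sub>F (i, m) in sequentially \<times>\<^sub>F sequentially. norm (a i m) \<le> norm (b i)"
      by (intro always_eventually) auto
  qed (use norm_b in auto)
  then show ?thesis
    by (simp only: sum_a sums_unique[OF b, symmetric])
qed

text \<open>The factor 1 + 1/x has no partner and joins 1 - x in the prefactor; the other factors
  pair up by the power of q. Factors from index N on only decrease the product, so finitely many
  remain. Squares are used because the squared moduli are polynomial in u.\<close>

lemma theta_sum_norm_le:
  fixes x :: complex
  assumes x: "x \<noteq> 0" and le1: "\<And>n. N \<le> n \<Longrightarrow> triple_factor x (q ^ Suc n) \<le> 1"
  shows "(cmod ((1 - x) * (partial_theta q x + partial_theta q (1 / x) / x)))\<^sup>2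
          \<le> (cmod (1 - x) * cmod (1 + x) / cmod x)\<^sup>2 * (\<Prod>n<N. triple_factor x (q ^ Suc n))"
proof (rule LIMSEQ_le_const2)
  let ?s = "\<lambda>m. of_real (qpoch q m) * ((\<Prod>n\<le>m. 1 + of_real (q ^ n) / x) * (\<Prod>n<m. 1 + x * of_real (q ^ Suc n)))"
  show "(\<lambda>m. (cmod ((1 - x) * ?s m))\<^sup>2) \<longlonglongrightarrow> (cmod ((1 - x) * (partial_theta q x + partial_theta q (1 / x) / x)))\<^sup>2"
    by (intro tendsto_intros jacobi_triple_product x)
  have s: "(cmod ((1 - x) * ?s m))\<^sup>2 = (cmod (1 - x) * cmod (1 + x) / cmod x)\<^sup>2 * (\<Prod>n<m. triple_factor x (q ^ Suc n))" for m
  proof -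
    have "(\<Prod>n\<le>m. 1 + of_real (q ^ n) / x) = (1 + 1 / x) * (\<Prod>n<m. 1 + of_real (q ^ Suc n) / x)"
      by (simp add: prod.atMost_shift)
    moreover have "1 + 1 / x = (1 + x) / x"
      using x by (simp add: field_simps)
    moreover have "(1 - x) * (w * ((1 + x) / x * a * b)) = (1 - x) * (1 + x) / x * (w * b * a)" for w a b
      by simp
    ultimately have "(1 - x) * ?s m = ((1 - x) * (1 + x) / x) *
        (\<Prod>n<m. of_real (1 - q ^ Suc n) * (1 + x * of_real (q ^ Suc n)) * (1 + of_real (q ^ Suc n) / x))"
      by (simp only: qpoch_def of_real_prod prod.distrib)
    also have "cmod \<dots> = (cmod (1 - x) * cmod (1 + x) / cmod x) *
        (\<Prod>n<m. (1 - q ^ Suc n) * cmod (1 + x * of_real (q ^ Suc n)) * cmod (1 + of_real (q ^ Suc n) / x))"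
    proof -
      have "cmod (of_real (1 - q ^ Suc n)) = 1 - q ^ Suc n" for n
        using q power_Suc_less_one[of q n] by (simp only: norm_of_real) simp
      then show ?thesis
        by (simp only: norm_mult norm_divide prod_norm[symmetric])
    qed
    finally show ?thesis
      by (simp only: power_mult_distrib triple_factor_def prod_power_distrib)
  qed
  show "\<exists>M. \<forall>m\<ge>M. (cmod ((1 - x) * ?s m))\<^sup>2 \<le> (cmod (1 - x) * cmod (1 + x) / cmod x)\<^sup>2 * (\<Prod>n<N. triple_factor x (q ^ Suc n))"
  proof (intro exI[of _ N] allI impI)
    fix m assume "N \<le> m"
    have nn: "0 \<le> triple_factor x u" for u by (simp add: triple_factor_def)
    have "(\<Prod>n<m. triple_factor x (q ^ Suc n)) = (\<Prod>n<N. triple_factor x (q ^ Suc n)) * (\<Prod>n=N..<m. triple_factor x (q ^ Suc n))"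
      using prod.atLeastLessThan_concat[of 0 N m "\<lambda>n. triple_factor x (q ^ Suc n)"] \<open>N \<le> m\<close>
      by (simp only: atLeast0LessThan le0)
    also have "\<dots> \<le> (\<Prod>n<N. triple_factor x (q ^ Suc n)) * 1"
      using nn le1 by (intro mult_left_mono prod_nonneg prod_le_1) auto
    finally show "(cmod ((1 - x) * ?s m))\<^sup>2 \<le> (cmod (1 - x) * cmod (1 + x) / cmod x)\<^sup>2 * (\<Prod>n<N. triple_factor x (q ^ Suc n))"
      unfolding s by (intro mult_left_mono) auto
  qed
qed

lemma Re_partial_theta_pos_by_reflection:
  fixes x :: complex
  assumes x: "x \<noteq> 0" and le1: "\<And>n. N \<le> n \<Longrightarrow> triple_factor x (q ^ Suc n) \<le> 1"
    and c: "0 \<le> c" "c \<le> Re ((1 - 1 / x) * partial_theta q (1 / x))"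
    and less: "(cmod (1 - x) * cmod (1 + x) / cmod x)\<^sup>2 * (\<Prod>n<N. triple_factor x (q ^ Suc n)) < c\<^sup>2"
  shows "0 < Re ((1 - x) * partial_theta q x)"
proof -
  define T where "T = (1 - x) * (partial_theta q x + partial_theta q (1 / x) / x)"
  have "(cmod T)\<^sup>2 < c\<^sup>2"
    unfolding T_def by (rule le_less_trans[OF theta_sum_norm_le[OF x le1] less])
  then have "cmod T < c"
    using c(1) by (rule power_less_imp_less_base)
  \<comment> \<open>Reflection: the second summand of T is (1/x - 1) times
    \<open>partial_theta q (1 / x)\<close>.\<close>
  moreover have "(1 - x) * partial_theta q x = T + (1 - 1 / x) * partial_theta q (1 / x)"
    using x by (simp add: T_def field_simps)
  moreover have "- cmod T \<le> Re T"
    using abs_Re_le_cmod[of T] by linarith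
  ultimately show ?thesis
    using c(2) by simp
qed

end

section \<open>Small $q$: estimates from the power series\<close>

lemma theta_gap_values:
  "theta_gap q 0 = 1 - q" "theta_gap q 1 = q * (1 - q^2)" "theta_gap q 2 = q^3 * (1 - q^3)"
  "theta_gap q 3 = q^6 * (1 - q^4)" "theta_gap q 4 = q^10 * (1 - q^5)"
  by (simp_all add: theta_gap_def theta_coeff_def power2_eq_square)

lemma Re_powers:
  fixes x :: complex
  shows "Re (x^2) = (Re x)^2 - (Im x)^2"
    and "Re (x^3) = (Re x)^3 - 3 * Re x * (Im x)^2"
    and "Re (x^4) = (Re x)^4 - 6 * (Re x)^2 * (Im x)^2 + (Im x)^4"
    and "Re (x^5) = (Re x)^5 - 10 * (Re x)^3 * (Im x)^2 + 5 * Re x * (Im x)^4"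
  by (simp_all add: power_numeral_reduce algebra_simps)

lemma theta_head_3:
  "(\<Sum>n<3. theta_gap q n * Re (x ^ Suc n)) =
     theta_gap q 0 * Re x + theta_gap q 1 * Re (x^2) + theta_gap q 2 * Re (x^3)"
  by (simp add: numeral_eq_Suc)

lemma theta_head_5:
  "(\<Sum>n<5. theta_gap q n * Re (x ^ Suc n)) =
     theta_gap q 0 * Re x + theta_gap q 1 * Re (x^2) + theta_gap q 2 * Re (x^3) +
     theta_gap q 3 * Re (x^4) + theta_gap q 4 * Re (x^5)"
  by (simp add: numeral_eq_Suc)

lemma mult_one_minus_mono:
  fixes u v :: real
  assumes "u \<le> v" "u + v \<le> 1"
  shows "u * (1 - u) \<le> v * (1 - v)"
proof -
  have "0 \<le> (v - u) * (1 - (u + v))" using assms by (intro mult_nonneg_nonneg) auto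
  then show ?thesis by (simp add: algebra_simps)
qed

lemma theta_gap_1_mono:
  assumes "0 \<le> p" "p \<le> q" "3 * q^2 \<le> 1"
  shows "theta_gap p 1 \<le> theta_gap q 1"
proof -
  have "p * p \<le> q * q" "p * q \<le> q * q"
    using assms by (auto intro!: mult_mono)
  then have "0 \<le> (q - p) * (1 - (q * q + q * p + p * p))"
    using assms by (intro mult_nonneg_nonneg) (auto simp: power2_eq_square mult_ac)
  also have "\<dots> = theta_gap q 1 - theta_gap p 1"
    unfolding theta_gap_values by (simp add: algebra_simps power2_eq_square)
  finally show ?thesis by linarith
qed

text \<open>The maximum of q - q^3, at 1/sqrt 3, lies inside this interval, so monotonicity is of no
  help. The value 3/8 is attained at 1/2, hence the factor q - 1/2; at 13/20 the cofactor is still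
  just positive.\<close>

lemma theta_gap_1_ge:
  assumes "1/2 \<le> q" "q \<le> 13/20"
  shows "3/8 \<le> theta_gap q 1"
proof -
  have "q^2 \<le> (13/20)^2" using assms by (intro power_mono) auto
  then have "0 \<le> (q - 1/2) * (3/4 - q/2 - q^2)"
    using assms by (intro mult_nonneg_nonneg) (auto simp: power2_eq_square)
  also have "\<dots> = theta_gap q 1 - 3/8"
    unfolding theta_gap_values by (simp add: field_simps power2_eq_square)
  finally show ?thesis by linarith
qed

lemma theta_gap_2_mono:
  assumes "0 \<le> p" "p \<le> q" "2 * q^3 \<le> 1"
  shows "theta_gap p 2 \<le> theta_gap q 2"
proof -
  have "p^3 \<le> q^3" using assms by (intro power_mono) auto
  with assms have "p^3 * (1 - p^3) \<le> q^3 * (1 - q^3)"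
    by (intro mult_one_minus_mono) linarith+
  then show ?thesis
    unfolding theta_gap_values .
qed

text \<open>Splitting off q^2 leaves t (1 - t) at t = q^4, which increases up to t = 1/2.\<close>

lemma theta_gap_3_mono:
  assumes "0 \<le> p" "p \<le> q" "2 * q^4 \<le> 1"
  shows "theta_gap p 3 \<le> theta_gap q 3"
proof -
  have m2: "p^2 \<le> q^2" and m4: "p^4 \<le> q^4" using assms by (intro power_mono; simp)+
  from m4 assms have m: "p^4 * (1 - p^4) \<le> q^4 * (1 - q^4)"
    by (intro mult_one_minus_mono) linarith+
  have "p^4 \<le> 1" using m4 assms by linarith
  then have nn: "0 \<le> p^4 * (1 - p^4)" by simp
  have "p^2 * (p^4 * (1 - p^4)) \<le> q^2 * (q^4 * (1 - q^4))"
    by (rule mult_mono[OF m2 m _ nn]) simp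
  moreover have "x^6 = x^2 * x^4" for x :: real by (simp flip: power_add)
  ultimately show ?thesis
    by (simp only: theta_gap_values mult.assoc)
qed

section \<open>Positivity on the boundary pieces for q below the thresholds\<close>

context
  fixes q :: real
  assumes q: "0 < q" "q < 1"
begin

lemma theta_tail_mono:
  assumes "q \<le> q0" "0 \<le> r" "q0 ^ Suc J * r < 1"
  shows "theta_coeff q J * r ^ Suc J / (1 - q ^ Suc J * r)
           \<le> theta_coeff q0 J * r ^ Suc J / (1 - q0 ^ Suc J * r)"
proof -
  have "q ^ Suc J * r \<le> q0 ^ Suc J * r"
    using assms q by (intro mult_right_mono power_mono) auto
  moreover have "theta_coeff q J \<le> theta_coeff q0 J"
    using assms q unfolding theta_coeff_def by (intro power_mono) auto
  ultimately show ?thesis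
    using assms theta_coeff_pos[OF q, of J] by (intro frac_le mult_right_mono) auto
qed

text \<open>The tail is evaluated at the largest admissible \<open>q0\<close>, where it is a number;
  only the head still depends on q.\<close>

lemma Re_partial_theta_pos_by_head:
  assumes r: "norm x \<le> r" and q0: "q \<le> q0" "q0 ^ Suc J * r < 1"
    and less: "(\<Sum>n<J. theta_gap q n * Re (x ^ Suc n)) + theta_coeff q0 J * r ^ Suc J / (1 - q0 ^ Suc J * r) < 1"
  shows "0 < Re ((1 - x) * partial_theta q x)"
proof -
  have r0: "0 \<le> r" using r norm_ge_zero order_trans by blast
  have "q ^ Suc J * r \<le> q0 ^ Suc J * r"
    using q0 q r0 by (intro mult_right_mono power_mono) auto
  then have "q ^ Suc J * r < 1" using q0(2) by linarith
  from Re_partial_theta_ge_outer[OF q r this] theta_tail_mono[OF q0(1) r0 q0(2)] less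
  show ?thesis by linarith
qed

text \<open>The ratio of the two coefficients is q^5 (1 + q^2), and 9/2 is the largest value of (Im
  x)^2: on the axis the x^2 term thus absorbs the x^4 term.\<close>

lemma theta_gap_3_le_1:
  assumes "q \<le> 13/20"
  shows "theta_gap q 3 * (9/2) \<le> theta_gap q 1"
proof -
  have "q^5 \<le> (13/20)^5" "q^2 \<le> (13/20)^2" using assms q by (intro power_mono; simp)+
  then have "q^5 * (1 + q^2) * (9/2) \<le> (13/20)^5 * (1 + (13/20)^2) * (9/2)"
    using q by (intro mult_mono) auto
  also have "\<dots> \<le> 1" by (simp add: power_divide)
  finally have "q * (1 - q^2) * (q^5 * (1 + q^2) * (9/2)) \<le> q * (1 - q^2) * 1"
    using q by (intro mult_left_mono) (auto simp: power_le_one)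
  moreover have "q^6 * (1 - q^4) = q * (1 - q^2) * (q^5 * (1 + q^2))"
    by (simp add: algebra_simps flip: power_add power_Suc)
  ultimately show ?thesis
    unfolding theta_gap_values by (simp only: mult_1_right mult.assoc)
qed

text \<open>From q^4 <= 1/16. On the far part of the line this lets the x^4 term pay for the x^5
  term.\<close>

lemma theta_gap_4_le_3:
  assumes "q \<le> 1/2"
  shows "15 * theta_gap q 4 \<le> theta_gap q 3"
proof -
  have "q^4 \<le> (1/2)^4" using assms q by (intro power_mono) auto
  then have "15 * q^4 \<le> 1 - q^4" by (simp add: power_divide)
  then have "15 * q^4 * (1 - q^5) \<le> (1 - q^4) * 1"
    using q by (intro mult_mono) (auto simp: power_le_one)
  then have "q^6 * (15 * q^4 * (1 - q^5)) \<le> q^6 * ((1 - q^4) * 1)"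
    using q by (intro mult_left_mono) auto
  moreover have "q^10 = q^6 * q^4" by (simp flip: power_add)
  ultimately show ?thesis
    unfolding theta_gap_values by (simp only: mult_1_right mult_ac)
qed

text \<open>Odd powers have no real part here, so five terms reduce to x^2 and x^4, with nonpositive
  total. Only the tail remains; 17/8 is a rational bound above 3/sqrt 2.\<close>

lemma Re_pos_imaginary_axis_low:
  assumes "q \<le> 13/20" "Re x = 0" "(Im x)^2 \<le> 9/2"
  shows "0 < Re ((1 - x) * partial_theta q x)"
proof (rule Re_partial_theta_pos_by_head[where J = 5 and r = "17/8" and ?q0.0 = "13/20"])
  have "(cmod x)^2 \<le> (17/8)^2"
    unfolding cmod_power2 using assms by (simp add: power_divide)
  then show "cmod x \<le> 17/8"
    by (rule power2_le_imp_le) simp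
  have "theta_gap q 3 * (Im x)^2 \<le> theta_gap q 3 * (9/2)"
    using assms theta_gap_pos[OF q, of 3] by (intro mult_left_mono) auto
  then have "(Im x)^2 * (theta_gap q 3 * (Im x)^2) \<le> (Im x)^2 * theta_gap q 1"
    using theta_gap_3_le_1 assms by (intro mult_left_mono) auto
  moreover have "(Im x)^2 * (theta_gap q 3 * (Im x)^2) = theta_gap q 3 * (Im x)^4"
    by (simp add: power_numeral_reduce)
  moreover have "(\<Sum>n<5. theta_gap q n * Re (x ^ Suc n)) = - ((Im x)^2 * theta_gap q 1) + theta_gap q 3 * (Im x)^4"
    unfolding theta_head_5 Re_powers assms(2) by simp
  ultimately have "(\<Sum>n<5. theta_gap q n * Re (x ^ Suc n)) \<le> 0"
    by linarith
  moreover have "theta_coeff (13/20) 5 * (17/8) ^ Suc 5 / (1 - (13/20) ^ Suc 5 * (17/8)) < (1::real)"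
    by (simp add: theta_coeff_def power_divide)
  ultimately show "(\<Sum>n<5. theta_gap q n * Re (x ^ Suc n)) + theta_coeff (13/20) 5 * (17/8) ^ Suc 5 / (1 - (13/20) ^ Suc 5 * (17/8)) < 1"
    by linarith
qed (use assms in \<open>simp_all add: power_divide\<close>)

lemma theta_head_line:
  assumes x: "Re x = - a" "(Im x)^2 = 9/2"
  shows "(\<Sum>n<5. theta_gap q n * Re (x ^ Suc n)) =
     - (theta_gap q 0 * a) - theta_gap q 1 * (9/2 - a^2) + theta_gap q 2 * (27/2 * a - a^3)
     + theta_gap q 3 * (a^4 - 27 * a^2 + 81/4) - theta_gap q 4 * (a^5 - 45 * a^3 + 405/4 * a)"
proof -
  have "(Im x)^4 = ((Im x)^2)^2" by (simp flip: power_mult)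
  then have "(Im x)^4 = 81/4" by (simp add: x power_divide)
  then show ?thesis
    by (simp only: theta_head_5 Re_powers x) (simp add: algebra_simps)
qed

text \<open>The harmful terms are x^3 and, for small a, x^4; the x^5 term is favourable for a <= 1
  and is dropped. Splitting the range of q keeps the numerical bounds on coefficients and tail sharp
  enough. The radius 47/20 comes from |x|^2 <= 11/2.\<close>

lemma Re_pos_line_low_near:
  assumes "q \<le> 13/20" "Re x = - a" "0 \<le> a" "a \<le> 1" "(Im x)^2 = 9/2"
  shows "0 < Re ((1 - x) * partial_theta q x)"
proof -
  have a2: "a^2 \<le> a" using assms by (simp add: power2_eq_square mult_left_le)
  have a4: "a^4 \<le> a^2" using assms by (intro power_decreasing) auto
  have "a^3 \<le> a" using power_decreasing[of 1 3 a] assms by simp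
  \<comment> \<open>Tangent bound at 17/20; it leaves only a and a^2 in the final checks.\<close>
  have cube: "17/10 * a^2 - 289/400 * a \<le> a^3"
  proof -
    have "0 \<le> a * (a - 17/20)^2" using assms by simp
    then show ?thesis by (simp add: algebra_simps power_numeral_reduce)
  qed
  have sq: "8/5 * a - 16/25 \<le> a^2"
  proof -
    have "0 \<le> (a - 4/5)^2" by simp
    then show ?thesis by (simp add: algebra_simps power2_eq_square)
  qed
  have "(cmod x)^2 \<le> (47/20)^2"
    unfolding cmod_power2 using assms a2 by (simp add: power_divide)
  then have r: "cmod x \<le> 47/20" by (rule power2_le_imp_le) simp
  have "0 \<le> a^5" using assms by simp
  moreover have "theta_gap q 4 * (45 * a^3) \<le> theta_gap q 4 * (45 * a)"
    using \<open>a^3 \<le> a\<close> theta_gap_pos[OF q, of 4] by simp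
  ultimately have "0 \<le> a^5 - 45 * a^3 + 405/4 * a"
    using \<open>a^3 \<le> a\<close> assms by linarith
  then have g4: "0 \<le> theta_gap q 4 * (a^5 - 45 * a^3 + 405/4 * a)"
    using theta_gap_pos[OF q, of 4] by simp
  have g3: "theta_gap q 3 * (a^4 - 27 * a^2 + 81/4) \<le> theta_gap q 3 * (81/4 - 26 * a^2)"
    using a4 theta_gap_pos[OF q, of 3] by (intro mult_left_mono) auto
  have p2: "0 \<le> 27/2 * a - a^3" using \<open>a^3 \<le> a\<close> assms by linarith
  define Y where "Y = 81/4 - 26 * a^2"
  \<comment> \<open>Each coefficient may be replaced by a number, rounded in the direction that the
    sign of its factor on 0 <= a <= 1 permits.\<close>
  have fin: ?thesis
    if "q \<le> q0" "q0 ^ Suc 5 * (47/20) < 1" "c1 \<le> theta_gap q 1" "theta_gap q 2 \<le> d2" "theta_gap q 3 * Y \<le> T"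
      and "theta_coeff q0 5 * (47/20) ^ Suc 5 / (1 - q0 ^ Suc 5 * (47/20)) < \<tau>"
      and "- ((1 - q0) * a) - c1 * (9/2 - a^2) + d2 * (27/2 * a - a^3) + T + \<tau> \<le> 1" for q0 c1 d2 T \<tau>
  proof (rule Re_partial_theta_pos_by_head[OF r that(1,2)])
    have "(1 - q0) * a \<le> theta_gap q 0 * a"
      unfolding theta_gap_values using that(1) assms by (intro mult_right_mono) auto
    moreover have "c1 * (9/2 - a^2) \<le> theta_gap q 1 * (9/2 - a^2)"
      using that(3) a2 assms by (intro mult_right_mono) auto
    moreover have "theta_gap q 2 * (27/2 * a - a^3) \<le> d2 * (27/2 * a - a^3)"
      using that(4) p2 by (intro mult_right_mono) auto
    moreover have "theta_gap q 3 * (a^4 - 27 * a^2 + 81/4) \<le> T"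
      using g3 that(5) unfolding Y_def by linarith
    ultimately show "(\<Sum>n<5. theta_gap q n * Re (x ^ Suc n)) + theta_coeff q0 5 * (47/20) ^ Suc 5 / (1 - q0 ^ Suc 5 * (47/20)) < 1"
      unfolding theta_head_line[OF assms(2,5)] using g4 that(6,7) by linarith
  qed
  note num = theta_gap_def theta_coeff_def power_divide
  consider "q \<le> 1/2" | "1/2 \<le> q" "q \<le> 3/5" | "3/5 \<le> q" by linarith
  then show ?thesis
  proof cases
    case 1
    have "theta_gap q 2 \<le> theta_gap (1/2) 2" "theta_gap q 3 \<le> theta_gap (1/2) 3"
      using 1 q by (auto intro!: theta_gap_2_mono theta_gap_3_mono simp: power_divide)
    then have g: "theta_gap q 2 \<le> 7/64" "theta_gap q 3 \<le> 15/1024" by (simp_all add: num)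
    have "theta_gap q 3 * Y \<le> theta_gap q 3 * (26 - 26 * a^2)"
      unfolding Y_def using theta_gap_pos[OF q, of 3] by (intro mult_left_mono) auto
    also have "\<dots> \<le> 15/1024 * (26 - 26 * a^2)"
      using g a2 assms by (intro mult_right_mono) auto
    finally have T: "theta_gap q 3 * Y \<le> 15/1024 * (26 - 26 * a^2)" .
    show ?thesis
    proof (rule fin[OF 1 _ _ g(1) T])
      show "0 \<le> theta_gap q 1" using theta_gap_pos[OF q] by (rule less_imp_le)
      show "theta_coeff (1/2) 5 * (47/20) ^ Suc 5 / (1 - (1/2) ^ Suc 5 * (47/20)) < (1/100::real)"
        by (simp add: num)
      show "- ((1 - 1/2) * a) - 0 * (9/2 - a^2) + 7/64 * (27/2 * a - a^3) + 15/1024 * (26 - 26 * a^2) + 1/100 \<le> 1"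
        using cube sq assms(3,4) a2 by (simp add: field_simps)
    qed (simp add: num)
  next
    case 2
    have "theta_gap q 2 \<le> theta_gap (3/5) 2" "theta_gap q 3 \<le> theta_gap (3/5) 3"
      using 2 q by (auto intro!: theta_gap_2_mono theta_gap_3_mono simp: power_divide)
    then have g: "theta_gap q 2 \<le> 17/100" "theta_gap q 3 \<le> 41/1000" by (simp_all add: num)
    have "theta_gap q 3 * Y \<le> theta_gap q 3 * (26 - 26 * a^2)"
      unfolding Y_def using theta_gap_pos[OF q, of 3] by (intro mult_left_mono) auto
    also have "\<dots> \<le> 41/1000 * (26 - 26 * a^2)"
      using g a2 assms by (intro mult_right_mono) auto
    finally have T: "theta_gap q 3 * Y \<le> 41/1000 * (26 - 26 * a^2)" .
    show ?thesis
    proof (rule fin[OF 2(2) _ theta_gap_1_ge g(1) T])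
      show "theta_coeff (3/5) 5 * (47/20) ^ Suc 5 / (1 - (3/5) ^ Suc 5 * (47/20)) < (1/10::real)"
        by (simp add: num)
      show "- ((1 - 3/5) * a) - 3/8 * (9/2 - a^2) + 17/100 * (27/2 * a - a^3) + 41/1000 * (26 - 26 * a^2) + 1/10 \<le> 1"
        using cube sq assms(3,4) a2 by (simp add: field_simps)
    qed (use 2 in \<open>simp_all add: num\<close>)
  next
    case 3
    have "theta_gap q 2 \<le> theta_gap (13/20) 2" "theta_gap q 3 \<le> theta_gap (13/20) 3" "theta_gap (3/5) 3 \<le> theta_gap q 3"
      using 3 q assms(1) theta_gap_2_mono[of q "13/20"] theta_gap_3_mono[of q "13/20"]
        theta_gap_3_mono[of "3/5" q] power_mono[OF assms(1), of 4]
      by (simp_all add: power_divide)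
    then have g: "theta_gap q 2 \<le> 1/5" "theta_gap q 3 \<le> 31/500" "1/25 \<le> theta_gap q 3" by (simp_all add: num)
    have g1: "3/8 \<le> theta_gap q 1" using 3 assms(1) by (intro theta_gap_1_ge) auto
    have tail: "theta_coeff (13/20) 5 * (47/20) ^ Suc 5 / (1 - (13/20) ^ Suc 5 * (47/20)) < (33/100::real)"
      by (simp add: num)
    have small: "(13/20) ^ Suc 5 * (47/20) < (1::real)" by (simp add: num)
    \<comment> \<open>\<open>Y\<close> changes sign within 0 <= a <= 1, so an upper or a lower bound
      for \<open>theta_gap q 3\<close> is needed.\<close>
    show ?thesis
    proof (cases "0 \<le> Y")
      case True
      then have T: "theta_gap q 3 * Y \<le> 31/500 * Y" using g by (intro mult_right_mono) auto
      show ?thesis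
        by (rule fin[OF assms(1) small g1 g(1) T tail], unfold Y_def) (use cube sq assms(3,4) in \<open>simp add: field_simps\<close>)
    next
      case False
      then have T: "theta_gap q 3 * Y \<le> 1/25 * Y" using g by (intro mult_right_mono_neg) auto
      show ?thesis
        by (rule fin[OF assms(1) small g1 g(1) T tail], unfold Y_def) (use cube sq assms(3,4) in \<open>simp add: field_simps\<close>)
    qed
  qed
qed

text \<open>For larger a the x^5 term can become harmful, while the x^4 term is now favourable.
  \<open>bracket\<close> lets the latter pay for the former and still keeps a gain of 5 a^2 times
  its coefficient. The tail, taken at the corner radius 3, is below 1/40.\<close>

lemma Re_pos_line_low_far:
  assumes "q \<le> 1/2" "Re x = - a" "1 \<le> a" "a^2 \<le> 9/2" "(Im x)^2 = 9/2"
  shows "0 < Re ((1 - x) * partial_theta q x)"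
proof -
  have "a^2 \<le> (10607/5000)^2" using assms by (simp add: power_divide)
  then have a: "a \<le> 10607/5000" by (rule power2_le_imp_le) simp
  have a0: "0 \<le> a" using assms by linarith
  have "(cmod x)^2 \<le> 3^2"
    unfolding cmod_power2 using assms by simp
  then have r: "cmod x \<le> 3" by (rule power2_le_imp_le) simp
  have "a * a^2 \<le> a * (9/2)" using assms a0 by (intro mult_left_mono) auto
  then have p2: "0 \<le> 27/2 * a - a^3" using a0 by (simp add: power_numeral_reduce)
  have bracket: "theta_gap q 3 * (a^4 - 27 * a^2 + 81/4) - theta_gap q 4 * (a^5 - 45 * a^3 + 405/4 * a)
      \<le> - (theta_gap q 3 * (5 * a^2))"
  proof -
    have a4: "a^4 - 22 * a^2 + 81/4 \<le> 0"
    proof -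
      have "0 \<le> (a^2 - 1) * (9/2 - a^2)"
        using assms by (intro mult_nonneg_nonneg) auto
      also have "\<dots> = 11/2 * a^2 - a^4 - 9/2"
        by (simp add: field_simps flip: power_add)
      finally show ?thesis using one_le_power[OF assms(3), of 2] by linarith
    qed
    show ?thesis
    proof (cases "0 \<le> a^5 - 45 * a^3 + 405/4 * a")
      case True
      have "0 \<le> theta_gap q 4 * (a^5 - 45 * a^3 + 405/4 * a)"
        using True theta_gap_pos[OF q, of 4] by simp
      moreover have "theta_gap q 3 * (a^4 - 22 * a^2 + 81/4) \<le> 0"
        using a4 theta_gap_pos[OF q, of 3] by (simp add: mult_le_0_iff)
      ultimately show ?thesis by (simp add: algebra_simps)
    next
      case False
      have "theta_gap q 4 * (45 * a^3 - 405/4 * a - a^5) \<le> theta_gap q 3 / 15 * (45 * a^3 - 405/4 * a - a^5)"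
        using False theta_gap_4_le_3[OF assms(1)] by (intro mult_right_mono) auto
      moreover have "theta_gap q 3 * (a^4 - 22 * a^2 + 81/4 + (45 * a^3 - 405/4 * a - a^5) / 15) \<le> 0"
      proof -
        have "a^2 * a^2 \<le> 9/2 * a^2" using assms by (intro mult_right_mono) auto
        moreover have "a * a^2 \<le> 10607/5000 * a^2" using a by (intro mult_right_mono) auto
        moreover have "2 * a - 1 \<le> a^2" using sum_power2_ge_zero[of "a - 1" 0] by (simp add: power2_diff)
        moreover have "0 \<le> a^5" using a0 by simp
        moreover have "a^4 = a^2 * a^2" "a^3 = a * a^2" by (simp_all add: power_numeral_reduce)
        \<comment> \<open>If a^2 <= 9/4, then 45 a^3 <= (405/4) a and the quintic would be
          nonnegative, contrary to the case assumption.\<close>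
        moreover have "9/4 < a^2"
        proof (rule ccontr)
          assume "\<not> 9/4 < a^2"
          then have "a * a^2 \<le> a * (9/4)" using a0 by (intro mult_left_mono) auto
          with False \<open>0 \<le> a^5\<close> \<open>a^3 = a * a^2\<close> show False by linarith
        qed
        moreover have "(45 * a^3 - 405/4 * a - a^5) / 15 = 3 * a^3 - 27/4 * a - a^5 / 15"
          by (simp add: field_simps)
        ultimately have "a^4 - 22 * a^2 + 81/4 + (45 * a^3 - 405/4 * a - a^5) / 15 \<le> 0"
          using assms(3) one_le_power[OF assms(3), of 2] by linarith
        then show ?thesis using theta_gap_pos[OF q, of 3] by (simp add: mult_le_0_iff)
      qed
      moreover have "theta_gap q 3 * (a^4 - 22 * a^2 + 81/4 + (45 * a^3 - 405/4 * a - a^5) / 15)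
          = theta_gap q 3 * (a^4 - 27 * a^2 + 81/4) + theta_gap q 3 * (5 * a^2)
            + theta_gap q 3 / 15 * (45 * a^3 - 405/4 * a - a^5)"
        by (simp add: field_simps)
      moreover have "theta_gap q 4 * (a^5 - 45 * a^3 + 405/4 * a) = - (theta_gap q 4 * (45 * a^3 - 405/4 * a - a^5))"
        by (simp add: algebra_simps)
      ultimately show ?thesis by linarith
    qed
  qed
  have fin: ?thesis
    if "q \<le> q0" "q0 \<le> 1/2" "c1 \<le> theta_gap q 1" "theta_gap q 2 \<le> d2" "c3 \<le> theta_gap q 3"
      and "- ((1 - q0) * a) - c1 * (9/2 - a^2) + d2 * (27/2 * a - a^3) - c3 * (5 * a^2) + 1/40 \<le> 1" for q0 c1 d2 c3
  proof (rule Re_partial_theta_pos_by_head[OF r assms(1)])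
    have "(1 - q0) * a \<le> theta_gap q 0 * a"
      unfolding theta_gap_values using that(1) a0 by (intro mult_right_mono) auto
    moreover have "c1 * (9/2 - a^2) \<le> theta_gap q 1 * (9/2 - a^2)"
      using that(3) assms by (intro mult_right_mono) auto
    moreover have "theta_gap q 2 * (27/2 * a - a^3) \<le> d2 * (27/2 * a - a^3)"
      using that(4) p2 by (intro mult_right_mono) auto
    moreover have "c3 * (5 * a^2) \<le> theta_gap q 3 * (5 * a^2)"
      using that(5) by (intro mult_right_mono) auto
    moreover have "theta_coeff (1/2) 5 * 3 ^ Suc 5 / (1 - (1/2) ^ Suc 5 * 3) < (1/40::real)"
      by (simp add: theta_coeff_def power_divide)
    ultimately show "(\<Sum>n<5. theta_gap q n * Re (x ^ Suc n)) + theta_coeff (1/2) 5 * 3 ^ Suc 5 / (1 - (1/2) ^ Suc 5 * 3) < 1"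
      unfolding theta_head_line[OF assms(2,5)] using bracket that(6) by linarith
  qed (simp add: power_divide)
  note num = theta_gap_def theta_coeff_def power_divide
  have cube: "2 * c * a^2 - c^2 * a \<le> a^3" for c
  proof -
    have "0 \<le> a * (a - c)^2" using a0 by simp
    then show ?thesis by (simp add: algebra_simps power2_diff power_numeral_reduce)
  qed
  show ?thesis
  proof (cases "q \<le> 9/20")
    case True
    have "theta_gap q 2 \<le> theta_gap (9/20) 2"
      using True q by (intro theta_gap_2_mono) (auto simp: power_divide)
    then have g: "theta_gap q 2 \<le> 83/1000" by (simp add: num)
    have "3 * a - 9/4 \<le> a^2" using sum_power2_ge_zero[of "a - 3/2" 0] by (simp add: power2_diff power_divide)
    with cube[of "3/2"] a
    have "- ((1 - 9/20) * a) - 0 * (9/2 - a^2) + 83/1000 * (27/2 * a - a^3) - 0 * (5 * a^2) + 1/40 \<le> 1"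
      by (simp add: field_simps)
    then show ?thesis
      using theta_gap_pos[OF q, of 1] theta_gap_pos[OF q, of 3]
      by (intro fin[OF True _ _ g, of 0 0]) auto
  next
    case False
    have "theta_gap q 2 \<le> theta_gap (1/2) 2" "theta_gap (9/20) 3 \<le> theta_gap q 3"
      using False assms(1) q power_mono[OF assms(1), of 4]
      by (auto intro!: theta_gap_2_mono theta_gap_3_mono simp: power_divide)
    moreover have "theta_gap (9/20) 1 \<le> theta_gap q 1"
      using False assms(1) q power_mono[OF assms(1), of 2]
      by (intro theta_gap_1_mono) (auto simp: power_divide)
    ultimately have g: "theta_gap q 2 \<le> 7/64" "79/10000 \<le> theta_gap q 3" "179/500 \<le> theta_gap q 1"
      by (simp_all add: num)
    \<comment> \<open>Tangent bounds at 53/25, just below the end point 3/sqrt 2 of the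
      range.\<close>
    have "106/25 * a - (53/25)^2 \<le> a^2" using sum_power2_ge_zero[of "a - 53/25" 0] by (simp add: power2_diff power_divide)
    with cube[of "53/25"] a
    have "- ((1 - 1/2) * a) - 179/500 * (9/2 - a^2) + 7/64 * (27/2 * a - a^3) - 79/10000 * (5 * a^2) + 1/40 \<le> 1"
      by (simp add: field_simps)
    then show ?thesis
      by (intro fin[OF assms(1) _ g(3,1,2)]) auto
  qed
qed

text \<open>On |x| = 3 the real parts of x^2 and x^3 are 2 a^2 - 9, which is harmful, and 27 a - 4
  a^3. Three terms suffice: at q = 2/5 the tail is just below 9/25.\<close>

lemma Re_pos_arc_low:
  assumes "q \<le> 2/5" "Re x = - a" "0 \<le> a" "a \<le> 3" "9/2 \<le> a^2" "a^2 + (Im x)^2 = 9"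
  shows "0 < Re ((1 - x) * partial_theta q x)"
proof -
  have t: "(Im x)^2 = 9 - a^2" using assms by linarith
  have "(cmod x)^2 \<le> 3^2" unfolding cmod_power2 using assms by simp
  then have r: "cmod x \<le> 3" by (rule power2_le_imp_le) simp
  have head: "(\<Sum>n<3. theta_gap q n * Re (x ^ Suc n)) =
      - (theta_gap q 0 * a) + theta_gap q 1 * (2 * a^2 - 9) - theta_gap q 2 * (4 * a^3 - 27 * a)"
    unfolding theta_head_3 Re_powers t assms(2) by (simp add: algebra_simps power_numeral_reduce)
  have fin: ?thesis
    if "q \<le> q0" "q0 \<le> 2/5" "theta_gap q 1 \<le> d1" "theta_gap q 2 * (27 * a - 4 * a^3) \<le> T"
      and "- ((1 - q0) * a) + d1 * (2 * a^2 - 9) + T + 9/25 \<le> 1" for q0 d1 T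
  proof (rule Re_partial_theta_pos_by_head[OF r assms(1)])
    have "(1 - q0) * a \<le> theta_gap q 0 * a"
      unfolding theta_gap_values using that(1) assms by (intro mult_right_mono) auto
    moreover have "theta_gap q 1 * (2 * a^2 - 9) \<le> d1 * (2 * a^2 - 9)"
      using that(3) assms by (intro mult_right_mono) auto
    moreover have "theta_coeff (2/5) 3 * 3 ^ Suc 3 / (1 - (2/5) ^ Suc 3 * 3) < (9/25::real)"
      by (simp add: theta_coeff_def power_divide)
    moreover have "theta_gap q 2 * (27 * a - 4 * a^3) = - (theta_gap q 2 * (4 * a^3 - 27 * a))"
      by (simp add: algebra_simps)
    ultimately show "(\<Sum>n<3. theta_gap q n * Re (x ^ Suc n)) + theta_coeff (2/5) 3 * 3 ^ Suc 3 / (1 - (2/5) ^ Suc 3 * 3) < 1"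
      unfolding head using that(4,5) by linarith
  qed (simp add: power_divide)
  note num = theta_gap_def theta_coeff_def power_divide
  have cube: "2 * c * a^2 - c^2 * a \<le> a^3" for c
  proof -
    have "0 \<le> a * (a - c)^2" using assms by simp
    then show ?thesis by (simp add: algebra_simps power2_diff power_numeral_reduce)
  qed
  have sq: "2 * c * a - c^2 \<le> a^2" for c
    using sum_power2_ge_zero[of "a - c" 0] by (simp add: power2_diff algebra_simps)
  have a3: "a^2 \<le> 3 * a" using assms by (simp add: power2_eq_square mult_right_mono)
  have lo: "21/10 \<le> a"
  proof (rule power2_le_imp_le)
    show "(21/10)^2 \<le> a^2" using assms by (simp add: power_divide)
  qed (use assms in auto)
  \<comment> \<open>The convex a^2 lies below its chord over [21/10, 3], an interval containing the
    range of a on the arc.\<close>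
  have chord: "a^2 \<le> 51/10 * a - 63/10"
  proof -
    have "0 \<le> (a - 21/10) * (3 - a)" using lo assms by (intro mult_nonneg_nonneg) auto
    also have "\<dots> = 51/10 * a - 63/10 - a^2" by (simp add: field_simps power2_eq_square)
    finally show ?thesis by linarith
  qed
  show ?thesis
  proof (cases "q \<le> 3/10")
    case True
    have "theta_gap q 2 \<le> theta_gap (3/10) 2"
      using True q by (intro theta_gap_2_mono) (auto simp: power_divide)
    moreover have "theta_gap q 1 \<le> theta_gap (3/10) 1"
      using True q by (intro theta_gap_1_mono) (auto simp: power_divide)
    ultimately have g: "theta_gap q 2 \<le> 27/1000" "theta_gap q 1 \<le> 273/1000"
      by (simp_all add: num)
    show ?thesis
    proof (cases "0 \<le> 27 * a - 4 * a^3")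
      case True
      then have T: "theta_gap q 2 * (27 * a - 4 * a^3) \<le> 27/1000 * (27 * a - 4 * a^3)"
        using g by (intro mult_right_mono) auto
      show ?thesis
        by (rule fin[OF \<open>q \<le> 3/10\<close> _ g(2) T])
          (use cube[of "24/10"] chord assms(4) lo in \<open>simp_all add: field_simps\<close>)
    next
      case False
      then have T: "theta_gap q 2 * (27 * a - 4 * a^3) \<le> 0"
        using theta_gap_pos[OF q, of 2] by (simp add: mult_le_0_iff)
      show ?thesis
        by (rule fin[OF \<open>q \<le> 3/10\<close> _ g(2) T]) (use chord assms(4) in \<open>simp_all add: field_simps\<close>)
    qed
  next
    case False
    then have "theta_gap q 2 \<le> theta_gap (2/5) 2" "theta_gap (3/10) 2 \<le> theta_gap q 2"
      using assms(1) q power_mono[OF assms(1), of 3]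
      by (auto intro!: theta_gap_2_mono simp: power_divide)
    moreover have "theta_gap q 1 \<le> theta_gap (2/5) 1"
      using assms(1) q by (intro theta_gap_1_mono) (auto simp: power_divide)
    ultimately have g: "theta_gap q 2 \<le> 6/100" "26/1000 \<le> theta_gap q 2" "theta_gap q 1 \<le> 336/1000"
      by (simp_all add: num)
    show ?thesis
    proof (cases "0 \<le> 27 * a - 4 * a^3")
      case True
      then have T: "theta_gap q 2 * (27 * a - 4 * a^3) \<le> 6/100 * (27 * a - 4 * a^3)"
        using g by (intro mult_right_mono) auto
      show ?thesis
        by (rule fin[OF assms(1) _ g(3) T])
          (use cube[of "24/10"] sq[of "5/2"] assms(4) in \<open>simp_all add: field_simps\<close>)
    next
      case False
      then have T: "theta_gap q 2 * (27 * a - 4 * a^3) \<le> 26/1000 * (27 * a - 4 * a^3)"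
        using g by (intro mult_right_mono_neg) auto
      show ?thesis
        by (rule fin[OF assms(1) _ g(3) T])
          (use cube[of 3] chord assms(4) in \<open>simp_all add: field_simps\<close>)
    qed
  qed
qed

end

section \<open>Large $q$: estimates from the triple product\<close>

lemma triple_factor_eq:
  assumes "x \<noteq> 0"
  shows "triple_factor x u = (1 - u)^2 * (1 + 2 * u * Re x + u^2 * (cmod x)^2) *
           (1 + 2 * u * Re x / (cmod x)^2 + u^2 / (cmod x)^2)"
proof -
  have 1: "(cmod (1 + x * of_real u))^2 = 1 + 2 * u * Re x + u^2 * (cmod x)^2"
    unfolding cmod_power2 by (simp add: power2_eq_square algebra_simps)
  have "1 + of_real u / x = (x + of_real u) / x"
    using assms by (simp add: field_simps)
  then have "(cmod (1 + of_real u / x))^2 = (cmod (x + of_real u))^2 / (cmod x)^2"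
    by (simp only: norm_divide power_divide)
  also have "(cmod (x + of_real u))^2 = (cmod x)^2 + 2 * u * Re x + u^2"
    unfolding cmod_power2 by (simp add: power2_eq_square algebra_simps)
  finally have 2: "(cmod (1 + of_real u / x))^2 = 1 + 2 * u * Re x / (cmod x)^2 + u^2 / (cmod x)^2"
    using assms by (simp add: add_divide_distrib)
  show ?thesis
    unfolding triple_factor_def power_mult_distrib 1 2 ..
qed

lemma triple_factor_nonneg: "0 \<le> triple_factor x u"
  by (simp add: triple_factor_def)

lemma theta_sum_prefactor_eq:
  assumes "x \<noteq> 0"
  shows "(cmod (1 - x) * cmod (1 + x) / cmod x)\<^sup>2 = ((1 + (cmod x)^2)^2 - 4 * (Re x)^2) / (cmod x)^2"
proof -
  have "(cmod (1 - x))^2 = (1 + (cmod x)^2) - 2 * Re x" "(cmod (1 + x))^2 = (1 + (cmod x)^2) + 2 * Re x"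
    unfolding cmod_power2 by (simp_all add: power2_eq_square algebra_simps)
  then show ?thesis
    by (simp add: power_divide power_mult_distrib) (simp add: power2_eq_square algebra_simps)
qed

lemma Re_inverse_power2:
  assumes "x \<noteq> 0"
  shows "Re ((1 / x)^2) = ((Re x)^2 - (Im x)^2) / (cmod x)^4"
proof -
  have "(cmod x)^4 = ((cmod x)^2)^2" by (simp flip: power_mult)
  then show ?thesis
    unfolding Re_powers Re_divide Im_divide cmod_power2
    by (simp add: power_divide diff_divide_distrib power2_eq_square)
qed

text \<open>Upper bounds for the factors of the triple product on the parts of the boundary. Since
  they decrease in $u$ (on the arc, up to a plateau that is dominated by the value at $4/25$), finitely
  many factors at the threshold value of $q$ suffice.\<close>

definition envelope :: "real \<Rightarrow> real" where
  "envelope u = (1 - u)^2 * (1 + 85/18 * u^2 + u^4)"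

text \<open>The derivative is 1 - x times a quartic. Dropping -6 x^4 and using x^3 <= x^2 leaves a
  quadratic with maximum near 8/25, where it is negative.\<close>

lemma envelope_antimono:
  assumes "0 \<le> u" "u \<le> v" "v \<le> 1"
  shows "envelope v \<le> envelope u"
proof (rule DERIV_nonpos_imp_nonincreasing[OF assms(2)])
  fix x assume x: "u \<le> x" "x \<le> v"
  let ?d = "2 * (1 - x) * (- 1) * (1 + 85/18 * x^2 + x^4) + (85/9 * x + 4 * x^3) * (1 - x)^2"
  have "(envelope has_real_derivative ?d) (at x)"
    unfolding envelope_def [abs_def] by (auto intro!: derivative_eq_intros)
  moreover have "?d \<le> 0"
  proof -
    have "x^3 \<le> x^2" using x assms by (intro power_decreasing) auto
    moreover have "16/25 * x - (8/25)^2 \<le> x^2"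
      using sum_power2_ge_zero[of "x - 8/25" 0] by (simp add: power2_diff power_divide)
    ultimately have le0: "-2 + 85/9 * x - 170/9 * x^2 + 4 * x^3 \<le> 0"
      using x assms by (simp add: field_simps)
    have "-2 + 85/9 * x - 170/9 * x^2 + 4 * x^3 - 6 * x^4 \<le> 0"
    proof -
      have "0 \<le> x^4" by simp
      with le0 show ?thesis by linarith
    qed
    then have "(1 - x) * (-2 + 85/9 * x - 170/9 * x^2 + 4 * x^3 - 6 * x^4) \<le> 0"
      using x assms by (intro mult_nonneg_nonpos) auto
    also have "(1 - x) * (-2 + 85/9 * x - 170/9 * x^2 + 4 * x^3 - 6 * x^4) = ?d"
      by (simp add: field_simps power_numeral_reduce)
    finally show ?thesis .
  qed
  ultimately show "\<exists>y. (envelope has_real_derivative y) (at x) \<and> y \<le> 0" by blast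
qed

lemma envelope_le_1: "0 \<le> u \<Longrightarrow> u \<le> 1 \<Longrightarrow> envelope u \<le> 1"
  using envelope_antimono[of 0 u] by (simp add: envelope_def)

lemma envelope_nonneg: "0 \<le> envelope u"
  by (simp add: envelope_def)

text \<open>This is (1 - u)^2 |1 + x u|^2 at a = 1, where the far part of the line begins; |1 + u/x|
  <= 1 is dropped.\<close>

definition envelope_far :: "real \<Rightarrow> real" where
  "envelope_far u = (1 - u)^4 + 9/2 * u^2 * (1 - u)^2"

lemma envelope_far_antimono:
  assumes "0 \<le> u" "u \<le> v" "v \<le> 1"
  shows "envelope_far v \<le> envelope_far u"
proof (rule DERIV_nonpos_imp_nonincreasing[OF assms(2)])
  fix x assume x: "u \<le> x" "x \<le> v"
  let ?d = "4 * (1 - x)^3 * (- 1) + (9 * x * (1 - x)^2 + 2 * (1 - x) * (- 1) * (9/2 * x^2))"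
  have "(envelope_far has_real_derivative ?d) (at x)"
    unfolding envelope_far_def [abs_def] by (auto intro!: derivative_eq_intros)
  moreover have "?d \<le> 0"
  proof -
    have "17/22 * x - (17/44)^2 \<le> x^2"
      using sum_power2_ge_zero[of "x - 17/44" 0] by (simp add: power2_diff power_divide)
    then have "- 4 + 17 * x - 22 * x^2 \<le> 0"
      by (simp add: field_simps)
    then have "(1 - x) * (- 4 + 17 * x - 22 * x^2) \<le> 0"
      using x assms by (intro mult_nonneg_nonpos) auto
    also have "(1 - x) * (- 4 + 17 * x - 22 * x^2) = ?d"
      by (simp add: field_simps power_numeral_reduce)
    finally show ?thesis .
  qed
  ultimately show "\<exists>y. (envelope_far has_real_derivative y) (at x) \<and> y \<le> 0" by blast
qed

text \<open>Up to u = 16/25, (1 - a u)^2 is at most (1 - u)^2. Beyond, a u may overshoot 1, but 1 -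
  u <= 9/25 pushes the value below \<open>envelope_far (1/2)\<close>; hence the condition v <=
  1/2.\<close>

lemma envelope_far_bound:
  assumes a: "1 \<le> a" "a \<le> 10607/5000" and u: "0 \<le> v" "v \<le> 1/2" "v \<le> u" "u \<le> 1"
  shows "(1 - u)^2 * ((1 - a * u)^2 + 9/2 * u^2) \<le> envelope_far v"
proof -
  have eq: "(1 - u)^2 * ((1 - u)^2 + 9/2 * u^2) = envelope_far u" for u :: real
    by (simp add: envelope_far_def field_simps power_numeral_reduce)
  have diff: "(1 - a * u)^2 - (1 - u)^2 = (a - 1) * u * ((a + 1) * u - 2)"
    by (simp add: power2_eq_square algebra_simps)
  show ?thesis
  proof (cases "u \<le> 16/25")
    case True
    have "(a + 1) * u \<le> (10607/5000 + 1) * (16/25)"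
      using True a u by (intro mult_mono) auto
    then have "(a - 1) * u * ((a + 1) * u - 2) \<le> 0"
      using a u by (intro mult_nonneg_nonpos) auto
    then have "(1 - a * u)^2 \<le> (1 - u)^2" using diff by linarith
    then have "(1 - u)^2 * ((1 - a * u)^2 + 9/2 * u^2) \<le> envelope_far u"
      unfolding eq[symmetric] by (intro mult_left_mono) auto
    also have "\<dots> \<le> envelope_far v"
      using u by (intro envelope_far_antimono)
    finally show ?thesis .
  next
    case False
    have "(a + 1) * u - 2 \<le> (a - 1) * u"
      using u by (simp add: algebra_simps)
    then have "(a - 1) * u * ((a + 1) * u - 2) \<le> (a - 1) * u * ((a - 1) * u)"
      using a u by (intro mult_left_mono mult_nonneg_nonneg) auto
    also have "\<dots> = (a - 1)^2 * u^2" by (simp add: power2_eq_square)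
    also have "\<dots> \<le> (5607/5000)^2 * u^2"
      using a by (intro mult_right_mono power_mono) auto
    also have "\<dots> \<le> 63/50 * u^2"
      by (intro mult_right_mono) (simp_all add: power_divide)
    finally have "(1 - a * u)^2 + 9/2 * u^2 \<le> (1 - u)^2 + 144/25 * u^2"
      using diff by linarith
    also have "\<dots> = 1 - 2 * u + 169/25 * u^2"
      by (simp add: power2_eq_square algebra_simps)
    finally have "(1 - u)^2 * ((1 - a * u)^2 + 9/2 * u^2) \<le> (1 - u)^2 * (1 - 2 * u + 169/25 * u^2)"
      by (intro mult_left_mono) auto
    also have "\<dots> = ((1 - u) * (1 - 2 * u + 169/25 * u^2)) * (1 - u)"
      by (simp add: power2_eq_square)
    also have "\<dots> \<le> ((9/25) * (1 - 2 * u + 169/25 * u^2)) * (1 - u)"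
    proof (intro mult_right_mono)
      have "0 \<le> (1 - u)^2 + 144/25 * u^2" by simp
      then show "0 \<le> 1 - 2 * u + 169/25 * u^2" by (simp add: power2_eq_square algebra_simps)
    qed (use False u in auto)
    also have "\<dots> \<le> envelope_far (1/2)"
    proof -
      have "(1 - 2 * u + 169/25 * u^2) * (1 - u) \<le> 95/100"
      proof -
        have "0 \<le> u * (u - 16/25)^2" using u by simp
        also have "\<dots> = u^3 - 32/25 * u^2 + 256/625 * u"
          by (simp add: field_simps power_numeral_reduce)
        finally have "32/25 * u^2 - 256/625 * u \<le> u^3" by simp
        moreover have "u^2 \<le> u" using u by (simp add: power2_eq_square mult_left_le)
        moreover have "(1 - 2 * u + 169/25 * u^2) * (1 - u) = 1 - 3 * u + 219/25 * u^2 - 169/25 * u^3"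
          by (simp add: field_simps power_numeral_reduce)
        ultimately show ?thesis using False by linarith
      qed
      then have "9/25 * ((1 - 2 * u + 169/25 * u^2) * (1 - u)) \<le> 9/25 * (95/100)"
        by (rule mult_left_mono) simp
      also have "\<dots> \<le> envelope_far (1/2)"
        by (simp add: envelope_far_def power_divide)
      finally show ?thesis by (simp only: mult.assoc)
    qed
    also have "\<dots> \<le> envelope_far v"
      using u by (intro envelope_far_antimono) auto
    finally show ?thesis .
  qed
qed

text \<open>Here 106/25 = 2 * 53/25, with 53/25 just below the smallest a on the arc; 9 is
  |x|^2.\<close>

definition envelope_arc :: "real \<Rightarrow> real" where
  "envelope_arc u = (1 - u)^2 * (1 - 106/25 * u + 9 * u^2)"

lemma envelope_arc_nonneg: "0 \<le> envelope_arc u"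
proof -
  have "0 \<le> (3 * u - 53/75)^2" by simp
  then have "0 \<le> 1 - 106/25 * u + 9 * u^2"
    by (simp add: power2_diff power_mult_distrib field_simps)
  then show ?thesis by (simp add: envelope_arc_def)
qed

text \<open>The point 13/25 is exactly the interior local maximum, so subtracting the value there
  leaves a double root. The other factor is a convex quadratic, nonpositive at 1/4 and at 1.\<close>

lemma envelope_arc_le_far:
  assumes "1/4 \<le> u" "u \<le> 1"
  shows "envelope_arc u \<le> 71/250"
proof -
  have "9 * u^2 - 322/25 * u + 1657/625 \<le> 0"
  proof -
    have "0 \<le> (u - 1/4) * (1 - u)" using assms by (intro mult_nonneg_nonneg) auto
    then have "u^2 \<le> 5/4 * u - 1/4" by (simp add: field_simps power2_eq_square)
    then show ?thesis using assms by (simp add: field_simps)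
  qed
  then have "(u - 13/25)^2 * (9 * u^2 - 322/25 * u + 1657/625) \<le> 0"
    by (intro mult_nonneg_nonpos) auto
  moreover have "envelope_arc u = (u - 13/25)^2 * (9 * u^2 - 322/25 * u + 1657/625) + (1 - 169/625 * (1657/625))"
    by (simp add: envelope_arc_def power_numeral_reduce field_simps)
  ultimately show ?thesis by simp
qed

text \<open>The envelope dips to a minimum at 1/3 and rises again, so it is not monotone; but its
  value at 4/25 exceeds everything on [1/4, 1]. The number 4/25 is the square of the threshold
  2/5.\<close>

lemma envelope_arc_mono:
  assumes "0 \<le> v" "v \<le> 4/25" "v \<le> u" "u \<le> 1"
  shows "envelope_arc u \<le> envelope_arc v"
proof -
  have near: "envelope_arc b \<le> envelope_arc a" if "0 \<le> a" "a \<le> b" "b \<le> 1/4" "a \<le> 4/25" for a b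
  proof -
    have "(b - a) * (9 * (a + b) - 106/25) \<le> 0"
      using that by (intro mult_nonneg_nonpos) auto
    then have "1 - 106/25 * b + 9 * b^2 \<le> 1 - 106/25 * a + 9 * a^2"
      by (simp add: field_simps power2_eq_square)
    moreover have "(1 - b)^2 \<le> (1 - a)^2"
      using that by (intro power_mono) auto
    moreover have "0 \<le> (3 * b - 53/75)^2" by simp
    then have "0 \<le> 1 - 106/25 * b + 9 * b^2"
      by (simp add: power2_diff power_mult_distrib field_simps)
    ultimately show ?thesis
      unfolding envelope_arc_def by (intro mult_mono) auto
  qed
  show ?thesis
  proof (cases "u \<le> 1/4")
    case True
    then show ?thesis using assms by (intro near) auto
  next
    case False
    then have "envelope_arc u \<le> 71/250"
      using assms by (intro envelope_arc_le_far) auto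
    also have "\<dots> \<le> envelope_arc (4/25)"
      by (simp add: envelope_arc_def power_divide)
    also have "\<dots> \<le> envelope_arc v"
      using assms by (intro near) auto
    finally show ?thesis .
  qed
qed

section \<open>Comparison of the factors with the envelopes\<close>

lemma sum_inverse_le:
  fixes s t :: real
  assumes "1 \<le> t" "t \<le> s"
  shows "t + 1 / t \<le> s + 1 / s"
proof -
  have "0 \<le> (s - t) * (1 - 1 / (s * t))"
    using assms mult_mono[of 1 s 1 t] by (intro mult_nonneg_nonneg) (auto simp: divide_le_eq)
  also have "\<dots> = s + 1 / s - (t + 1 / t)"
    using assms by (simp add: field_simps)
  finally show ?thesis by simp
qed

text \<open>Without linear terms the two moduli multiply to 1 + (t + 1/t) u^2 + u^4 with t = (Im
  x)^2, and t + 1/t increases for t >= 1. The bound s is used as 9/2 and as 2.\<close>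

lemma triple_factor_imaginary:
  assumes "Re x = 0" "1 \<le> (Im x)^2" "(Im x)^2 \<le> s"
  shows "triple_factor x u \<le> (1 - u)^2 * (1 + (s + 1 / s) * u^2 + u^4)"
proof -
  have x: "x \<noteq> 0" using assms by auto
  have R: "(cmod x)^2 = (Im x)^2" unfolding cmod_power2 by (simp add: assms)
  define t where "t = (Im x)^2"
  have "triple_factor x u = (1 - u)^2 * (1 + (t + 1 / t) * u^2 + u^4)"
  proof -
    have "0 < t" using assms(2) unfolding t_def by linarith
    then have "(1 + u^2 * t) * (1 + u^2 / t) = 1 + (t + 1 / t) * u^2 + u^4"
      by (simp add: field_simps power_numeral_reduce)
    then show ?thesis
      unfolding triple_factor_eq[OF x] R t_def[symmetric] by (simp add: assms(1))
  qed
  also have "\<dots> \<le> (1 - u)^2 * (1 + (s + 1 / s) * u^2 + u^4)"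
  proof (rule mult_left_mono)
    have "(t + 1 / t) * u^2 \<le> (s + 1 / s) * u^2"
      using assms by (intro mult_right_mono sum_inverse_le) (auto simp: t_def)
    then show "1 + (t + 1 / t) * u^2 + u^4 \<le> 1 + (s + 1 / s) * u^2 + u^4" by simp
  qed simp
  finally show ?thesis .
qed

lemma triple_factor_line_near:
  assumes "Re x = - a" "0 \<le> a" "a \<le> 1" "(Im x)^2 = 9/2" "0 \<le> u" "u \<le> 1"
  shows "triple_factor x u \<le> envelope u"
proof -
  have x: "x \<noteq> 0" using assms by auto
  have R: "(cmod x)^2 = a^2 + 9/2" unfolding cmod_power2 by (simp add: assms)
  have "0 \<le> a * u" "a * u \<le> 1" using assms by (auto intro: mult_le_one)
  then have "(1 - a * u)^2 \<le> 1" by (simp add: power_le_one)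
  then have A: "1 + 2 * u * (- a) + u^2 * (a^2 + 9/2) \<le> 1 + 9/2 * u^2"
    by (simp add: power2_eq_square algebra_simps)
  have "0 \<le> (1 - a * u)^2 + 9/2 * u^2" by simp
  then have A0: "0 \<le> 1 + 2 * u * (- a) + u^2 * (a^2 + 9/2)"
    by (simp add: power2_eq_square algebra_simps)
  have B: "1 + 2 * u * (- a) / (a^2 + 9/2) + u^2 / (a^2 + 9/2) \<le> 1 + 2/9 * u^2"
  proof -
    have "2 * u * (- a) / (a^2 + 9/2) \<le> 0"
      using assms by (intro divide_nonpos_pos) (auto intro: add_nonneg_pos)
    moreover have "u^2 / (a^2 + 9/2) \<le> u^2 / (9/2)"
      by (intro divide_left_mono) (auto intro: add_nonneg_pos mult_pos_pos)
    ultimately show ?thesis by simp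
  qed
  have "triple_factor x u \<le> (1 - u)^2 * (1 + 2 * u * (- a) + u^2 * (a^2 + 9/2)) * (1 + 2/9 * u^2)"
    unfolding triple_factor_eq[OF x] R assms(1) using A0 by (intro mult_left_mono B mult_nonneg_nonneg) auto
  also have "\<dots> \<le> (1 - u)^2 * (1 + 9/2 * u^2) * (1 + 2/9 * u^2)"
    by (intro mult_right_mono mult_left_mono A) auto
  \<comment> \<open>The middle coefficient is 9/2 + 2/9 = 85/18, the same as on the axis for s =
    9/2.\<close>
  also have "\<dots> = envelope u"
    by (simp add: envelope_def field_simps power_numeral_reduce)
  finally show ?thesis .
qed

text \<open>Moving x to the right by u <= 2 a does not increase its modulus, so |1 + u/x| <=
  1.\<close>

lemma triple_factor_le_outer:
  assumes "x \<noteq> 0" "Re x = - a" "0 \<le> u" "u \<le> 2 * a"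
  shows "triple_factor x u \<le> (1 - u)^2 * (1 - 2 * u * a + u^2 * (cmod x)^2)"
proof -
  have "0 \<le> (cmod (1 + x * of_real u))^2" by simp
  also have "\<dots> = 1 - 2 * u * a + u^2 * (cmod x)^2"
    unfolding cmod_power2 by (simp add: assms power2_eq_square algebra_simps)
  finally have A: "0 \<le> (1 - u)^2 * (1 - 2 * u * a + u^2 * (cmod x)^2)" by simp
  have "u * u \<le> u * (2 * a)" using assms by (intro mult_left_mono)
  then have "u^2 / (cmod x)^2 \<le> 2 * u * a / (cmod x)^2"
    by (intro divide_right_mono) (auto simp: power2_eq_square)
  then have "1 + 2 * u * (- a) / (cmod x)^2 + u^2 / (cmod x)^2 \<le> 1" by simp
  from mult_left_mono[OF this A] show ?thesis
    unfolding triple_factor_eq[OF assms(1)] assms(2) by simp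
qed

lemma triple_factor_line_far:
  assumes "Re x = - a" "1 \<le> a" "a^2 \<le> 9/2" "(Im x)^2 = 9/2" "0 \<le> v" "v \<le> 1/2" "v \<le> u" "u \<le> 1"
  shows "triple_factor x u \<le> envelope_far v"
proof -
  have x: "x \<noteq> 0" using assms by auto
  have R: "(cmod x)^2 = a^2 + 9/2" unfolding cmod_power2 by (simp add: assms)
  have "a^2 \<le> (10607/5000)^2" using assms by (simp add: power_divide)
  then have a: "a \<le> 10607/5000" by (rule power2_le_imp_le) simp
  have "triple_factor x u \<le> (1 - u)^2 * (1 - 2 * u * a + u^2 * (a^2 + 9/2))"
    using triple_factor_le_outer[OF x assms(1), of u] assms unfolding R by auto
  also have "\<dots> = (1 - u)^2 * ((1 - a * u)^2 + 9/2 * u^2)"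
    by (simp add: power2_eq_square algebra_simps)
  also have "\<dots> \<le> envelope_far v"
    using assms a by (intro envelope_far_bound)
  finally show ?thesis .
qed

lemma triple_factor_arc:
  assumes "Re x = - a" "0 \<le> a" "9/2 \<le> a^2" "cmod x = 3" "0 \<le> u" "u \<le> 1"
  shows "triple_factor x u \<le> envelope_arc u"
proof -
  have x: "x \<noteq> 0" using assms by auto
  have "(53/25)^2 \<le> a^2" using assms by (simp add: power_divide)
  then have a: "53/25 \<le> a" by (rule power2_le_imp_le) (use assms in auto)
  have "triple_factor x u \<le> (1 - u)^2 * (1 - 2 * u * a + u^2 * 9)"
    using triple_factor_le_outer[OF x assms(1), of u] assms a by auto
  also have "\<dots> \<le> envelope_arc u"
    unfolding envelope_arc_def using mult_left_mono[OF a, of "2 * u"] assms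
    by (intro mult_left_mono) auto
  finally show ?thesis .
qed

text \<open>Short lower bounds for $(13/20)^{n+2}$ that keep the exact evaluation of the product cheap.\<close>

definition lower_powers :: "real list" where
  "lower_powers = [42/100, 27/100, 178/1000, 11/100, 75/1000, 49/1000, 31/1000, 2/100]"

text \<open>The factor at u = q is left out, since on the axis it must be treated
  separately.\<close>

lemma envelope_prod_le:
  assumes q: "13/20 \<le> q" "q < 1"
  shows "(\<Prod>n<8. envelope (q ^ Suc (Suc n))) \<le> 1071/5000"
proof -
  have low: "lower_powers ! n \<le> q ^ Suc (Suc n)" "0 \<le> lower_powers ! n" if "n < 8" for n
  proof -
    have "lower_powers ! n \<le> (13/20) ^ Suc (Suc n) \<and> 0 \<le> lower_powers ! n"
      using that by (auto simp: lower_powers_def numeral_eq_Suc less_Suc_eq)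
    moreover have "(13/20) ^ Suc (Suc n) \<le> q ^ Suc (Suc n)"
      using q by (intro power_mono) auto
    ultimately show "lower_powers ! n \<le> q ^ Suc (Suc n)" "0 \<le> lower_powers ! n" by auto
  qed
  have "(\<Prod>n<8. envelope (q ^ Suc (Suc n))) \<le> (\<Prod>n<8. envelope (lower_powers ! n))"
    using q low by (intro prod_mono conjI envelope_nonneg envelope_antimono power_le_one) auto
  also have "\<dots> \<le> 1071/5000"
    by (simp add: lower_powers_def envelope_def lessThan_nat_numeral lessThan_Suc power_divide)
  finally show ?thesis .
qed

section \<open>Positivity on the boundary pieces for q above the thresholds\<close>

context
  fixes q :: real
  assumes q: "0 < q" "q < 1"
begin

lemma power_bounds: "0 \<le> q ^ n" "q ^ n \<le> 1"
  using q by (auto intro: power_le_one)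

text \<open>For |Im x| <= 1 the unit disc bound applies without reflection. For 1 < t <= 2 both
  sides of the comparison carry (1 - q)^2; for t > 2 the reflected part is at least 3/4 and
  constants suffice.\<close>

lemma Re_pos_imaginary_axis_high:
  assumes q0: "13/20 \<le> q" and x: "Re x = 0" "(Im x)^2 \<le> 9/2"
  shows "0 < Re ((1 - x) * partial_theta q x)"
proof (cases "(Im x)^2 \<le> 1")
  case True
  then have "(cmod x)^2 \<le> 1^2" unfolding cmod_power2 by (simp add: x)
  then have r: "cmod x \<le> 1" by (rule power2_le_imp_le) simp
  have "(\<Sum>n<3. theta_gap q n * Re (x ^ Suc n)) = - (theta_gap q 1 * (Im x)^2)"
    unfolding theta_head_3 Re_powers x(1) by simp
  moreover have "0 \<le> theta_gap q 1 * (Im x)^2"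
    using theta_gap_pos[OF q, of 1] by simp
  moreover have "theta_coeff q 3 * 1 ^ Suc 3 < 1"
    using q by (simp add: theta_coeff_def power_less_one_iff)
  ultimately show ?thesis
    using Re_partial_theta_ge_inner[OF q r, of 3] by linarith
next
  case False
  define t where "t = (Im x)^2"
  have t: "1 < t" "t \<le> 9/2" using False x by (auto simp: t_def)
  have x0: "x \<noteq> 0" using False by auto
  have R: "(cmod x)^2 = t" unfolding cmod_power2 by (simp add: x t_def)
  have R4: "(cmod x)^4 = t^2" unfolding R[symmetric] by (simp flip: power_mult)
  have inner: "1 - q^6 / t^2 \<le> Re ((1 - 1 / x) * partial_theta q (1 / x))"
  proof -
    have "1 \<le> cmod x" by (rule power2_le_imp_le) (use R t in auto)
    then have r: "cmod (1 / x) \<le> 1 / cmod x" "1 / cmod x \<le> 1" by (auto simp: norm_divide divide_le_eq)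
    have re: "Re (1 / x) = 0" by (simp add: Re_divide x)
    have "(\<Sum>n<3. theta_gap q n * Re ((1 / x) ^ Suc n)) = - (theta_gap q 1 * (t / t^2))"
      unfolding theta_head_3 Re_inverse_power2[OF x0] R4 Re_powers(2) re x(1) by (simp add: t_def)
    moreover have "0 \<le> theta_gap q 1 * (t / t^2)"
      using theta_gap_pos[OF q, of 1] t by simp
    moreover have "theta_coeff q 3 * (1 / cmod x) ^ Suc 3 = q^6 / t^2"
      using R4 by (simp add: theta_coeff_def power_divide)
    ultimately show ?thesis
      using Re_partial_theta_ge_inner[OF q r, of 3] by linarith
  qed
  have "q^6 / t^2 \<le> q^6 / 1"
    using t q one_le_power[of t 2] by (intro divide_left_mono) auto
  then have qt: "1 - q^6 \<le> 1 - q^6 / t^2" by simp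
  have pre: "(cmod (1 - x) * cmod (1 + x) / cmod x)\<^sup>2 = t + 1 / t + 2"
    unfolding theta_sum_prefactor_eq[OF x0] R x(1) using t by (simp add: field_simps power2_eq_square)
  have tf: "triple_factor x (q ^ n) \<le> envelope (q ^ n)" for n
    using triple_factor_imaginary[OF x(1) _ x(2), of "q ^ n"] False by (simp add: envelope_def)
  have P: "(\<Prod>n<8. triple_factor x (q ^ Suc (Suc n))) \<le> 1071/5000"
  proof -
    have "(\<Prod>n<8. triple_factor x (q ^ Suc (Suc n))) \<le> (\<Prod>n<8. envelope (q ^ Suc (Suc n)))"
      by (intro prod_mono conjI triple_factor_nonneg tf)
    with envelope_prod_le[OF q0 q(2)] show ?thesis by linarith
  qed
  have P0: "0 \<le> (\<Prod>n<8. triple_factor x (q ^ Suc (Suc n)))"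
    by (intro prod_nonneg ballI triple_factor_nonneg)
  have split: "(\<Prod>n<9. triple_factor x (q ^ Suc n)) = triple_factor x q * (\<Prod>n<8. triple_factor x (q ^ Suc (Suc n)))"
    using prod.lessThan_Suc_shift[of "\<lambda>n. triple_factor x (q ^ Suc n)" 8] by simp
  show ?thesis
  proof (rule Re_partial_theta_pos_by_reflection[OF q x0 _ _ inner, where N = 9])
    show "triple_factor x (q ^ Suc n) \<le> 1" for n
      using tf[of "Suc n"] envelope_le_1[OF power_bounds[of "Suc n"]] by linarith
    show "0 \<le> 1 - q^6 / t^2" using qt power_bounds[of 6] by linarith
    show "(cmod (1 - x) * cmod (1 + x) / cmod x)\<^sup>2 * (\<Prod>n<9. triple_factor x (q ^ Suc n)) < (1 - q^6 / t^2)\<^sup>2"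
    proof (cases "t \<le> 2")
      case True
      \<comment> \<open>For $t$ near $1$ the right-hand side may vanish with $1 - q$, so the factor $(1 - q)^2$ has to be kept.\<close>
      have "triple_factor x q \<le> (1 - q)^2 * (1 + (2 + 1 / 2) * q^2 + q^4)"
        using True t by (intro triple_factor_imaginary x(1)) (auto simp: t_def)
      also have "\<dots> \<le> (1 - q)^2 * (9/2)"
        using power_bounds[of 2] power_bounds[of 4] by (intro mult_left_mono) auto
      finally have A: "triple_factor x q * (\<Prod>n<8. triple_factor x (q ^ Suc (Suc n))) \<le> ((1 - q)^2 * (9/2)) * (1071/5000)"
        by (intro mult_mono P P0) auto
      have "t + 1 / t + 2 \<le> 9/2" using sum_inverse_le[of t 2] True t by simp
      from mult_mono[OF this A _ mult_nonneg_nonneg[OF triple_factor_nonneg P0]]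
      have "(t + 1 / t + 2) * (\<Prod>n<9. triple_factor x (q ^ Suc n)) \<le> 9/2 * (((1 - q)^2 * (9/2)) * (1071/5000))"
        unfolding split by simp
      also have "\<dots> < 441/100 * (1 - q)^2" using q by simp
      also have "\<dots> = ((1 - q) * (21/10))^2" unfolding power_mult_distrib by (simp add: power_divide)
      also have "\<dots> \<le> (1 - q^6 / t^2)^2"
      proof (intro power_mono)
        have "(13/20)^2 \<le> q^2" "(13/20)^3 \<le> q^3" using q0 by (intro power_mono; simp)+
        then have "21/10 \<le> 1 + q + q^2 + q^3"
          using q0 by (simp add: power_divide)
        then have "21/10 \<le> 1 + q + q^2 + q^3 + (q^4 + q^5)"
          using power_bounds(1)[of 4] power_bounds(1)[of 5] by linarith
        then have "(1 - q) * (21/10) \<le> (1 - q) * (1 + q + q^2 + q^3 + (q^4 + q^5))"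
          using q by (intro mult_left_mono) auto
        also have "\<dots> = 1 - q^6" by (simp add: algebra_simps power_numeral_reduce)
        finally show "(1 - q) * (21/10) \<le> 1 - q^6 / t^2" using qt by linarith
      qed (use q in auto)
      finally show ?thesis unfolding pre .
    next
      case False
      have "envelope q \<le> envelope (13/20)" using q0 q by (intro envelope_antimono) auto
      also have "\<dots> \<le> 389/1000" by (simp add: envelope_def power_divide)
      finally have "triple_factor x q \<le> 389/1000" using tf[of 1] by simp
      then have A: "triple_factor x q * (\<Prod>n<8. triple_factor x (q ^ Suc (Suc n))) \<le> 389/1000 * (1071/5000)"
        by (intro mult_mono P P0) auto
      have "t + 1 / t + 2 \<le> 121/18" using sum_inverse_le[of t "9/2"] t by simp
      from mult_mono[OF this A _ mult_nonneg_nonneg[OF triple_factor_nonneg P0]]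
      have "(t + 1 / t + 2) * (\<Prod>n<9. triple_factor x (q ^ Suc n)) \<le> 121/18 * (389/1000 * (1071/5000))"
        unfolding split by simp
      also have "\<dots> < (3/4)^2" by (simp add: power_divide)
      also have "\<dots> \<le> (1 - q^6 / t^2)^2"
      proof (intro power_mono)
        have "2^2 \<le> t^2" using False by (intro power_mono) auto
        then have "q^6 / t^2 \<le> 1 / 2^2" using power_bounds[of 6] by (intro frac_le) auto
        then show "3/4 \<le> 1 - q^6 / t^2" by simp
      qed simp
      finally show ?thesis unfolding pre .
    qed
  qed
qed

text \<open>On the line |Re x| <= |Im x|, so 1/x and its square both have nonpositive real part. The
  remainder is at most |1/x|^3 < 11/100, with 943/2000 just above sqrt 2/3.\<close>

lemma Re_partial_theta_inverse_line_ge: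
  assumes "Re x = - a" "0 \<le> a" "a^2 \<le> 9/2" "(Im x)^2 = 9/2"
  shows "89/100 \<le> Re ((1 - 1 / x) * partial_theta q (1 / x))"
proof -
  have x0: "x \<noteq> 0" using assms by auto
  have R: "(cmod x)^2 = a^2 + 9/2" unfolding cmod_power2 by (simp add: assms)
  have "(2000/943)^2 \<le> (cmod x)^2" unfolding R by (simp add: power_divide add_increasing)
  then have "2000/943 \<le> cmod x" by (rule power2_le_imp_le) simp
  then have "1 / cmod x \<le> 1 / (2000/943)" by (intro frac_le) auto
  then have r: "cmod (1 / x) \<le> 943/2000" by (simp add: norm_divide)
  have "Re (1 / x) \<le> 0" using assms by (simp add: Re_divide divide_nonpos_nonneg)
  moreover have "Re ((1 / x)^2) \<le> 0"
    unfolding Re_inverse_power2[OF x0] using assms by (intro divide_nonpos_nonneg) auto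
  ultimately have "theta_gap q 0 * Re (1 / x) + theta_gap q 1 * Re ((1 / x)^2) \<le> 0"
    using theta_gap_pos[OF q] by (intro add_nonpos_nonpos mult_nonneg_nonpos) (auto intro: less_imp_le)
  moreover have "(\<Sum>n<2. theta_gap q n * Re ((1 / x) ^ Suc n)) = theta_gap q 0 * Re (1 / x) + theta_gap q 1 * Re ((1 / x)^2)"
    by (simp add: numeral_eq_Suc)
  moreover have "theta_coeff q 2 * (943/2000) ^ Suc 2 \<le> 1 * (11/100)"
    using power_bounds by (intro mult_mono) (auto simp: theta_coeff_def power_divide)
  ultimately show ?thesis
    using Re_partial_theta_ge_inner[OF q r, of 2] by linarith
qed

lemma theta_sum_prefactor_line:
  assumes "Re x = - a" "(Im x)^2 = 9/2"
  shows "(cmod (1 - x) * cmod (1 + x) / cmod x)\<^sup>2 = (a^4 + 7 * a^2 + 121/4) / (a^2 + 9/2)"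
proof -
  have x0: "x \<noteq> 0" using assms by auto
  have R: "(cmod x)^2 = a^2 + 9/2" unfolding cmod_power2 by (simp add: assms)
  have "(1 + (a^2 + 9/2))^2 - 4 * (- a)^2 = a^4 + 7 * a^2 + 121/4"
    by (simp add: field_simps power_numeral_reduce)
  then show ?thesis
    unfolding theta_sum_prefactor_eq[OF x0] R assms(1) by simp
qed

lemma Re_pos_line_high_near:
  assumes q0: "13/20 \<le> q" and x: "Re x = - a" "0 \<le> a" "a \<le> 1" "(Im x)^2 = 9/2"
  shows "0 < Re ((1 - x) * partial_theta q x)"
proof -
  have x0: "x \<noteq> 0" using x by auto
  have a2: "a^2 \<le> 1" using x by (simp add: power_le_one)
  have tf: "triple_factor x (q ^ n) \<le> envelope (q ^ n)" for n
    using x power_bounds by (intro triple_factor_line_near)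
  have "(\<Prod>n<9. triple_factor x (q ^ Suc n)) \<le> (\<Prod>n<9. envelope (q ^ Suc n))"
    by (intro prod_mono conjI triple_factor_nonneg tf)
  also have "\<dots> = envelope q * (\<Prod>n<8. envelope (q ^ Suc (Suc n)))"
    using prod.lessThan_Suc_shift[of "\<lambda>n. envelope (q ^ Suc n)" 8] by simp
  also have "\<dots> \<le> 389/1000 * (1071/5000)"
  proof (intro mult_mono envelope_prod_le[OF q0 q(2)] prod_nonneg ballI envelope_nonneg)
    have "envelope q \<le> envelope (13/20)" using q0 q by (intro envelope_antimono) auto
    also have "\<dots> \<le> 389/1000" by (simp add: envelope_def power_divide)
    finally show "envelope q \<le> 389/1000" .
  qed simp
  finally have P: "(\<Prod>n<9. triple_factor x (q ^ Suc n)) \<le> 389/1000 * (1071/5000)" .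
  have pre: "(a^4 + 7 * a^2 + 121/4) / (a^2 + 9/2) \<le> 7"
  proof -
    have "a^4 \<le> 1" using x by (simp add: power_le_one)
    moreover have "0 < a^2 + 9/2" by (intro add_nonneg_pos) auto
    ultimately show ?thesis by (simp add: pos_divide_le_eq)
  qed
  show ?thesis
  proof (rule Re_partial_theta_pos_by_reflection[OF q x0 _ _ Re_partial_theta_inverse_line_ge[OF x(1,2) _ x(4)], where N = 9])
    show "triple_factor x (q ^ Suc n) \<le> 1" for n
      using tf[of "Suc n"] envelope_le_1[OF power_bounds[of "Suc n"]] by linarith
    have "(a^4 + 7 * a^2 + 121/4) / (a^2 + 9/2) * (\<Prod>n<9. triple_factor x (q ^ Suc n)) \<le> 7 * (389/1000 * (1071/5000))"
      by (intro mult_mono pre P prod_nonneg ballI triple_factor_nonneg) auto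
    also have "\<dots> < (89/100)^2" by (simp add: power_divide)
    finally show "(cmod (1 - x) * cmod (1 + x) / cmod x)\<^sup>2 * (\<Prod>n<9. triple_factor x (q ^ Suc n)) < (89/100)\<^sup>2"
      unfolding theta_sum_prefactor_line[OF x(1,4)] .
  qed (use a2 in auto)
qed

text \<open>Already at q = 1/2, five factors fall below 73/1000, because for a >= 1 the term (1 - a
  u)^2 helps. The prefactor peaks at the corner, where it is 82/9 < 46/5.\<close>

lemma Re_pos_line_high_far:
  assumes q0: "1/2 \<le> q" and x: "Re x = - a" "1 \<le> a" "a^2 \<le> 9/2" "(Im x)^2 = 9/2"
  shows "0 < Re ((1 - x) * partial_theta q x)"
proof -
  have x0: "x \<noteq> 0" using x by auto
  have half: "(1/2) ^ n \<le> q ^ n" for n using q0 by (intro power_mono) auto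
  have "(\<Prod>n<5. triple_factor x (q ^ Suc n)) \<le> (\<Prod>n<5. envelope_far ((1/2) ^ Suc n))"
  proof (intro prod_mono conjI triple_factor_nonneg triple_factor_line_far[OF x])
    show "(1/2) ^ Suc n \<le> (1/2::real)" for n
      using power_decreasing[of 1 "Suc n" "1/2::real"] by simp
    show "(1/2) ^ Suc n \<le> q ^ Suc n" "q ^ Suc n \<le> 1" for n
      by (fact half power_bounds)+
  qed simp
  also have "\<dots> \<le> 73/1000"
    by (simp add: envelope_far_def lessThan_nat_numeral lessThan_Suc power_divide)
  finally have P: "(\<Prod>n<5. triple_factor x (q ^ Suc n)) \<le> 73/1000" .
  have pre: "(a^4 + 7 * a^2 + 121/4) / (a^2 + 9/2) \<le> 46/5"
  proof -
    have "0 \<le> (9/2 - a^2) * (a^2 + 23/10)" using x by (intro mult_nonneg_nonneg) auto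
    also have "\<dots> = 11/5 * a^2 - a^4 + 207/20" by (simp add: field_simps flip: power_add)
    finally have "a^4 + 7 * a^2 + 121/4 \<le> 46/5 * (a^2 + 9/2)" by simp
    moreover have "0 < a^2 + 9/2" by (intro add_nonneg_pos) auto
    ultimately show ?thesis by (simp add: pos_divide_le_eq)
  qed
  show ?thesis
  proof (rule Re_partial_theta_pos_by_reflection[OF q x0 _ _ Re_partial_theta_inverse_line_ge[OF x(1) _ x(3,4)], where N = 5])
    show "triple_factor x (q ^ Suc n) \<le> 1" for n
      using triple_factor_line_far[OF x, of 0 "q ^ Suc n"] power_bounds[of "Suc n"]
      by (simp add: envelope_far_def)
    have "(a^4 + 7 * a^2 + 121/4) / (a^2 + 9/2) * (\<Prod>n<5. triple_factor x (q ^ Suc n)) \<le> 46/5 * (73/1000)"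
      by (intro mult_mono pre P prod_nonneg ballI triple_factor_nonneg) auto
    also have "\<dots> < (89/100)^2" by (simp add: power_divide)
    finally show "(cmod (1 - x) * cmod (1 + x) / cmod x)\<^sup>2 * (\<Prod>n<5. triple_factor x (q ^ Suc n)) < (89/100)\<^sup>2"
      unfolding theta_sum_prefactor_line[OF x(1,4)] .
  qed (use x in auto)
qed

text \<open>The first factor has u = q >= 2/5, beyond the decreasing range, and gets the plateau
  bound 71/250; the next three are compared at powers of 2/5. The prefactor is largest at the
  corner, 82/9.\<close>

lemma Re_pos_arc_high:
  assumes q0: "2/5 \<le> q" and x: "Re x = - a" "0 \<le> a" "9/2 \<le> a^2" "cmod x = 3"
  shows "0 < Re ((1 - x) * partial_theta q x)"
proof -
  have x0: "x \<noteq> 0" using x by auto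
  have low: "(2/5) ^ n \<le> q ^ n" for n using q0 by (intro power_mono) auto
  have tf: "triple_factor x (q ^ n) \<le> envelope_arc (q ^ n)" for n
    using x power_bounds by (intro triple_factor_arc)
  have tf_mono: "triple_factor x (q ^ n) \<le> envelope_arc v" if "0 \<le> v" "v \<le> 4/25" "v \<le> q ^ n" for v n
    using tf[of n] envelope_arc_mono[OF that power_bounds(2)] by linarith
  have "(\<Prod>n<4. triple_factor x (q ^ Suc n)) =
      triple_factor x (q ^ 1) * triple_factor x (q ^ 2) * triple_factor x (q ^ 3) * triple_factor x (q ^ 4)"
    by (simp add: numeral_eq_Suc)
  also have "\<dots> \<le> 71/250 * envelope_arc (4/25) * envelope_arc (8/125) * envelope_arc (16/625)"
  proof (intro mult_mono mult_nonneg_nonneg triple_factor_nonneg envelope_arc_nonneg)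
    show "triple_factor x (q ^ 1) \<le> 71/250"
      using tf[of 1] envelope_arc_le_far[of q] q0 q by simp
    show "triple_factor x (q ^ 2) \<le> envelope_arc (4/25)"
      using low[of 2] by (intro tf_mono) (auto simp: power_divide)
    show "triple_factor x (q ^ 3) \<le> envelope_arc (8/125)"
      using low[of 3] by (intro tf_mono) (auto simp: power_divide)
    show "triple_factor x (q ^ 4) \<le> envelope_arc (16/625)"
      using low[of 4] by (intro tf_mono) (auto simp: power_divide)
  qed simp_all
  also have "\<dots> \<le> 17/250"
    by (simp add: envelope_arc_def power_divide)
  finally have P: "(\<Prod>n<4. triple_factor x (q ^ Suc n)) \<le> 17/250" .
  have pre: "(cmod (1 - x) * cmod (1 + x) / cmod x)\<^sup>2 \<le> 82/9"
  proof -
    have "(cmod (1 - x) * cmod (1 + x) / cmod x)\<^sup>2 = (100 - 4 * a^2) / 9"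
      using theta_sum_prefactor_eq[OF x0] by (simp add: x(1,4))
    moreover have "(100 - 4 * a^2) / 9 \<le> 82 / 9" using x(3) by simp
    ultimately show ?thesis by (simp only:)
  qed
  have inner: "8/9 \<le> Re ((1 - 1 / x) * partial_theta q (1 / x))"
  proof -
    have r: "cmod (1 / x) \<le> 1/3" by (simp add: norm_divide x)
    have "Re (1 / x) \<le> 0" using x by (simp add: Re_divide divide_nonpos_nonneg)
    then have "theta_gap q 0 * Re (1 / x) \<le> 0"
      using theta_gap_pos[OF q, of 0] by (simp add: mult_le_0_iff)
    moreover have "(\<Sum>n<1. theta_gap q n * Re ((1 / x) ^ Suc n)) = theta_gap q 0 * Re (1 / x)"
      by simp
    moreover have "theta_coeff q 1 * (1/3) ^ Suc 1 \<le> 1 * (1/9)"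
      using q by (intro mult_mono) (auto simp: theta_coeff_def power_divide)
    ultimately show ?thesis
      using Re_partial_theta_ge_inner[OF q r, of 1] by linarith
  qed
  show ?thesis
  proof (rule Re_partial_theta_pos_by_reflection[OF q x0 _ _ inner, where N = 4])
    show "triple_factor x (q ^ Suc n) \<le> 1" for n
      using tf_mono[of 0 "Suc n"] power_bounds[of "Suc n"] by (simp add: envelope_arc_def)
    have "(cmod (1 - x) * cmod (1 + x) / cmod x)\<^sup>2 * (\<Prod>n<4. triple_factor x (q ^ Suc n)) \<le> 82/9 * (17/250)"
      by (intro mult_mono pre P prod_nonneg ballI triple_factor_nonneg) auto
    also have "\<dots> < (8/9)^2" by (simp add: power_divide)
    finally show "(cmod (1 - x) * cmod (1 + x) / cmod x)\<^sup>2 * (\<Prod>n<4. triple_factor x (q ^ Suc n)) < (8/9)\<^sup>2" .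
  qed simp
qed

end

section \<open>The maximum principle\<close>

text \<open>The regimes meet at q = 13/20 on the axis and on the line for a <= 1, at 1/2 on the line
  for a >= 1, and at 2/5 on the arc. |x| <= 3 gives a^2 <= 9/2 on the line, and |Im x| <= 3/sqrt 2
  gives a^2 >= 9/2 on the arc.\<close>

lemma Re_one_minus_partial_theta_pos_on_boundary:
  assumes q: "0 < q" "q < 1" and x: "cmod x \<le> 3" "Re x \<le> 0" "(Im x)^2 \<le> 9/2"
    and boundary: "Re x = 0 \<or> (Im x)^2 = 9/2 \<or> cmod x = 3"
  shows "0 < Re ((1 - x) * partial_theta q x)"
proof -
  define a where "a = - Re x"
  have a: "Re x = - a" "0 \<le> a" using x by (auto simp: a_def)
  have R: "(cmod x)^2 = a^2 + (Im x)^2" unfolding cmod_power2 by (simp add: a_def)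
  have R9: "a^2 + (Im x)^2 \<le> 9"
    using power_mono[OF x(1) norm_ge_zero, of 2] R by simp
  have a3: "a \<le> 3"
    using abs_Re_le_cmod[of x] x(1) a by linarith
  consider "Re x = 0" | "(Im x)^2 = 9/2" | "cmod x = 3" using boundary by blast
  then show ?thesis
  proof cases
    case 1
    then show ?thesis
      using Re_pos_imaginary_axis_low[OF q _ 1 x(3)] Re_pos_imaginary_axis_high[OF q _ 1 x(3)] by linarith
  next
    case 2
    then have a2: "a^2 \<le> 9/2" using R9 by linarith
    show ?thesis
    proof (cases "a \<le> 1")
      case True
      then show ?thesis
        using Re_pos_line_low_near[OF q _ a True 2] Re_pos_line_high_near[OF q _ a True 2] by linarith
    next
      case False
      then have "1 \<le> a" by simp
      then show ?thesis
        using Re_pos_line_low_far[OF q _ a(1) _ a2 2] Re_pos_line_high_far[OF q _ a(1) _ a2 2] by linarith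
    qed
  next
    case 3
    then have "a^2 + (Im x)^2 = 9" using R by simp
    moreover from this have "9/2 \<le> a^2" using x(3) by linarith
    ultimately show ?thesis
      using Re_pos_arc_low[OF q _ a a3] Re_pos_arc_high[OF q _ a _ 3] by linarith
  qed
qed

theorem theorem1:
  fixes q :: real and x :: complex
  assumes "0 < q" and "q < 1"
    and "cmod x \<le> 3" and "Re x \<le> 0" and "\<bar>Im x\<bar> \<le> 3 / sqrt 2"
  shows "partial_theta q x \<noteq> 0"
proof -
  define D where "D = {x. cmod x \<le> 3 \<and> Re x \<le> 0 \<and> \<bar>Im x\<bar> \<le> 3 / sqrt 2}"
  define g where "g = (\<lambda>x. (1 - x) * partial_theta q x)"
  have Im: "(Im x)^2 \<le> 9/2" if "\<bar>Im x\<bar> \<le> 3 / sqrt 2" for x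
    using power_mono[OF that abs_ge_zero, of 2] by (simp add: power_divide)
  have "closed D"
    unfolding D_def by (intro closed_Collect_conj closed_Collect_le continuous_intros)
  have "bounded D"
    unfolding bounded_iff D_def by blast
  then have compact: "compact (frontier D)"
    by (rule compact_frontier_bounded)
  have pos: "0 < Re (g y)" if y: "y \<in> frontier D" for y
  proof -
    have "y \<in> D" using y \<open>closed D\<close> frontier_subset_closed by blast
    \<comment> \<open>Inclusion of this open set in the interior is enough: a frontier point must
      violate a strict inequality.\<close>
    define U where "U = {x. cmod x < 3 \<and> Re x < 0 \<and> \<bar>Im x\<bar> < 3 / sqrt 2}"
    have "open U"
      unfolding U_def by (intro open_Collect_conj open_Collect_less continuous_intros)
    moreover have "U \<subseteq> D" by (auto simp: U_def D_def)
    ultimately have "U \<subseteq> interior D" by (rule interior_maximal[rotated])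
    then have "y \<notin> U" using y by (auto simp: frontier_def)
    then have "Re y = 0 \<or> \<bar>Im y\<bar> = 3 / sqrt 2 \<or> cmod y = 3"
      using \<open>y \<in> D\<close> by (auto simp: U_def D_def)
    moreover have "(Im y)^2 = 9/2" if "\<bar>Im y\<bar> = 3 / sqrt 2"
    proof -
      have "\<bar>Im y\<bar>^2 = (3 / sqrt 2)^2" by (simp only: that)
      then show ?thesis by (simp add: power_divide)
    qed
    ultimately show ?thesis
      unfolding g_def using \<open>y \<in> D\<close> Im[of y]
      by (intro Re_one_minus_partial_theta_pos_on_boundary assms(1,2)) (auto simp: D_def)
  qed
  have holo: "g holomorphic_on S" for S
    unfolding g_def by (intro holomorphic_intros holomorphic_partial_theta assms(1,2))
  have "x \<in> D" using assms by (simp add: D_def)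
  have "frontier D \<noteq> {}"
  proof
    assume "frontier D = {}"
    then have "D = {} \<or> D = UNIV" by (simp add: frontier_eq_empty)
    with \<open>x \<in> D\<close> \<open>bounded D\<close> show False by (auto simp: not_bounded_UNIV)
  qed
  \<comment> \<open>The maximum principle transports a fixed bound, and the bound 0 would lose
    strictness. Compactness supplies a positive minimum of Re g on the frontier.\<close>
  moreover have "continuous_on (frontier D) (\<lambda>y. Re (g y))"
    by (intro continuous_on_Re holomorphic_on_imp_continuous_on holo)
  ultimately obtain y where y: "y \<in> frontier D" "\<And>z. z \<in> frontier D \<Longrightarrow> Re (g y) \<le> Re (g z)"
    using continuous_attains_inf[OF compact] by blast
  have "Re (- g x) \<le> - Re (g y)"
  proof (rule maximum_real_frontier[where f = "\<lambda>z. - g z" and S = D])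
    show "(\<lambda>z. - g z) holomorphic_on interior D"
      by (intro holomorphic_on_minus holo)
    show "continuous_on (closure D) (\<lambda>z. - g z)"
      by (intro continuous_on_minus holomorphic_on_imp_continuous_on holo)
    show "Re (- g z) \<le> - Re (g y)" if "z \<in> frontier D" for z
      using y(2)[OF that] by simp
  qed fact+
  with pos[OF y(1)] have "0 < Re (g x)" by simp
  then show ?thesis by (auto simp: g_def)
qed

end
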